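(* Let $\mathcal{L}$ be a $\lambda$-graph bisystem satisfying FPCC. The equivalence relation $R_{\mathcal{L}}$ on $\mathcal{X}_{\mathcal{L}}$, with its inductive limit topology, is an étale AF equivalence relation.
   Context: **$\lambda$-graph bisystem.** Let $\Sigma$ be a finite set. A $\lambda$-graph bisystem $\mathcal{L}=(\mathcal{L}^-,\mathcal{L}^+)$ over $\Sigma$ consists of two labeled Bratteli diagrams $\mathcal{L}^{-}=(V,E^{-},\lambda^{-})$, $\mathcal{L}^{+}=(V,E^{+},\lambda^{+})$ with common vertex set $V=\bigcup_{l\ge 0}V_l$ and edge sets $E^-=\bigcup_{l\ge0}E^-_{l+1,l}$, $E^+=\bigcup_{l\ge0}E^+_{l,l+1}$ (all $V_l$, $E^-_{l+1,l}$, $E^+_{l,l+1}$ are finite, nonempty and pairwise disjoint, and $V_0$ is a singleton). An edge $e^-\in E^-_{l+1,l}$ has source $s(e^-)\in V_{l+1}$ and terminal $t(e^-)\in V_l$; an edge $e^+\in E^+_{l,l+1}$ has source $s(e^+)\in V_l$ and terminal $t(e^+)\in V_{l+1}$; labels are given by $\lambda^\pm:E^\pm\to\Sigma$. Required: (1) $\mathcal{L}^-$ is right-resolving: distinct $e^-,f^-\in E^-_{l+1,l}$ with $s(e^-)=s(f^-)$ have $\lambda^-(e^-)\neq\lambda^-(f^-)$; (2) $\mathcal{L}^+$ is left-resolving: distinct $e^+,f^+\in E^+_{l,l+1}$ with $t(e^+)=t(f^+)$ have $\lambda^+(e^+)\ne\lambda^+(f^+)$; (3) local property: for all $u\in V_l$,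 $v\in V_{l+2}$ there is a bijection $\phi$ from $\{(f^+,f^-)\in E^+_{l,l+1}\times E^-_{l+2,l+1}: s(f^+)=u,\ t(f^+)=t(f^-),\ s(f^-)=v\}$ onto $\{(e^-,e^+)\in E^-_{l+1,l}\times E^+_{l+1,l+2}: t(e^-)=u,\ s(e^-)=s(e^+),\ t(e^+)=v\}$ such that $\phi(f^+,f^-)=(e^-,e^+)$ implies $\lambda^+(f^+)=\lambda^+(e^+)$ and $\lambda^-(f^-)=\lambda^-(e^-)$. For $v\in V_l$, let $F(v)\subset\Sigma^l$ be the set of words $(\lambda^-(e^-_l),\dots,\lambda^-(e^-_1))$ with $e^-_n\in E^-_{n,n-1}$, $s(e^-_l)=v$, $t(e_n^-)=s(e_{n-1}^-)$, and let $P(v)\subset\Sigma^l$ be the set of words $(\lambda^+(e^+_1),\dots,\lambda^+(e^+_l))$ with $e^+_n\in E^+_{n-1,n}$, $t(e^+_l)=v$, $s(e^+_n)=t(e^+_{n-1})$. FPCC means $F(v)=P(v)$ for all $v\in V$. **Configuration space.** Let $\mathbb{Z}^2[<]=\{(k,l)\in\mathbb{Z}^2: k<l\}$, $n(k,l)=l-k-1$, $V_{(k,l)}=V_{n(k,l)}$, $E^-_{(k-1,k),l}=E^-_{n(k-1,l),n(k,l)}$, $E^+_{k,(l,l+1)}=E^+_{n(k,l),n(k,l+1)}$. $\mathcal{X}_{\mathcal{L}}$ is the set of configurations $x=\{(v_{(k,l)},e^-_{(k-1,k),l},e^+_{k,(l,l+1)})\}_{(k,l)\in\mathbb{Z}^2[<]}$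 with $v_{(k,l)}\in V_{(k,l)}$, $e^-_{(k-1,k),l}\in E^-_{(k-1,k),l}$, $e^+_{k,(l,l+1)}\in E^+_{k,(l,l+1)}$, such that $s(e^-_{(k-1,k),l})=v_{(k-1,l)}$, $t(e^-_{(k-1,k),l})=v_{(k,l)}$, $s(e^+_{k,(l,l+1)})=v_{(k,l)}$, $t(e^+_{k,(l,l+1)})=v_{(k,l+1)}$, and such that there is $(x_n)_{n\in\mathbb{Z}}\in\Sigma^{\mathbb{Z}}$ with $\lambda^-(e^-_{(k-1,k),l})=x_k$ and $\lambda^+(e^+_{k,(l,l+1)})=x_l$ for all $(k,l)\in\mathbb{Z}^2[<]$. For $v\in V_{(p,q)}$ and $\mu=(\mu_{p+1},\dots,\mu_{q-1})\in P(v)$ let $U_{(\mu;v)}$ be the set of $x\in\mathcal{X}_{\mathcal{L}}$ whose vertex at $(p,q)$ is $v$ and whose labels satisfy $(x_{p+1},\dots,x_{q-1})=\mu$. These sets (over all $(p,q)\in\mathbb{Z}^2[<]$) form a base of the topology of $\mathcal{X}_{\mathcal{L}}$ (a compact totally disconnected metrizable space). **Equivalence relation.** For $(p,q)\in\mathbb{Z}^2[<]$, $\square_{(p,q)}(x)$ is the restriction of $x$ to all $v_{(k,l)},e^-_{(k-1,k),l},e^+_{k,(l,l+1)}$ with $k\le p$, $l\ge q$. Put $R_{\mathcal{L}_{(p,q)}}=\{(x,z):\square_{(p,q)}(x)=\square_{(p,q)}(z)\}\subset\mathcal{X}_{\mathcal{L}}\times\mathcal{X}_{\mathcal{L}}$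 with the relative product topology. Then $R_{\mathcal{L}_{(p,q)}}\subset R_{\mathcal{L}_{(p',q')}}$ whenever $p'\le p$ and $q\le q'$, and $R_{\mathcal{L}}=\bigcup_{(p,q)}R_{\mathcal{L}_{(p,q)}}$ carries the inductive limit topology. **AF.** A topologized equivalence relation $R$ on a compact metrizable space is étale if (as a topological groupoid) its two projections $r(x,z)=x$, $s(x,z)=z$ are local homeomorphisms; an étale equivalence relation on a compact totally disconnected metrizable space is AF if it is the union of an increasing sequence of subequivalence relations each of which is compact and open in $R$. *)

theory Defs
  imports "HOL-Analysis.Analysis"
begin

section \<open>\<open>\<lambda>\<close>-graph bisystems\<close>

text \<open>
  \<open>Eminus L l\<close> is \<open>E\<^sup>-\<^bsub>l+1,l\<^esub>\<close> (edges from level \<open>l + 1\<close> down to level \<open>l\<close>) and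
  \<open>Eplus L l\<close> is \<open>E\<^sup>+\<^bsub>l,l+1\<^esub>\<close> (edges from level \<open>l\<close> up to level \<open>l + 1\<close>).
  Vertices, downward edges and upward edges live in separate types, so these three kinds
  of objects need no disjointness assumptions between each other.
\<close>

record ('v, 'm, 'p, 'a) bisystem =
  Vert :: "nat \<Rightarrow> 'v set"
  Eminus :: "nat \<Rightarrow> 'm set"
  Eplus :: "nat \<Rightarrow> 'p set"
  src_minus :: "'m \<Rightarrow> 'v"
  trm_minus :: "'m \<Rightarrow> 'v"
  lab_minus :: "'m \<Rightarrow> 'a"
  src_plus :: "'p \<Rightarrow> 'v"
  trm_plus :: "'p \<Rightarrow> 'v"
  lab_plus :: "'p \<Rightarrow> 'a"

locale lambda_graph_bisystem =
  fixes \<Sigma> :: "'a set" and L :: "('v, 'm, 'p, 'a) bisystem"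
  assumes finite_alphabet: "finite \<Sigma>"
    and Vert_finite: "\<And>l. finite (Vert L l)"
    and Vert_nonempty: "\<And>l. Vert L l \<noteq> {}"
    and Vert_disjoint: "disjoint_family (Vert L)"
    and Vert_0: "is_singleton (Vert L 0)"
    and Eminus_finite: "\<And>l. finite (Eminus L l)"
    and Eminus_nonempty: "\<And>l. Eminus L l \<noteq> {}"
    and Eminus_disjoint: "disjoint_family (Eminus L)"
    and Eplus_finite: "\<And>l. finite (Eplus L l)"
    and Eplus_nonempty: "\<And>l. Eplus L l \<noteq> {}"
    and Eplus_disjoint: "disjoint_family (Eplus L)"
    and src_minus: "\<And>l e. e \<in> Eminus L l \<Longrightarrow> src_minus L e \<in> Vert L (l + 1)"
    and trm_minus: "\<And>l e. e \<in> Eminus L l \<Longrightarrow> trm_minus L e \<in> Vert L l"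
    and lab_minus: "\<And>l e. e \<in> Eminus L l \<Longrightarrow> lab_minus L e \<in> \<Sigma>"
    and src_plus: "\<And>l e. e \<in> Eplus L l \<Longrightarrow> src_plus L e \<in> Vert L l"
    and trm_plus: "\<And>l e. e \<in> Eplus L l \<Longrightarrow> trm_plus L e \<in> Vert L (l + 1)"
    and lab_plus: "\<And>l e. e \<in> Eplus L l \<Longrightarrow> lab_plus L e \<in> \<Sigma>"
    and right_resolving:
      "\<And>l e f. \<lbrakk>e \<in> Eminus L l; f \<in> Eminus L l; e \<noteq> f; src_minus L e = src_minus L f\<rbrakk>
        \<Longrightarrow> lab_minus L e \<noteq> lab_minus L f"
    and left_resolving:
      "\<And>l e f. \<lbrakk>e \<in> Eplus L l; f \<in> Eplus L l; e \<noteq> f; trm_plus L e = trm_plus L f\<rbrakk>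
        \<Longrightarrow> lab_plus L e \<noteq> lab_plus L f"
    and local_property:
      "\<And>l u v. \<lbrakk>u \<in> Vert L l; v \<in> Vert L (l + 2)\<rbrakk> \<Longrightarrow>
        \<exists>\<phi>. bij_betw \<phi>
              {(fp, fm) \<in> Eplus L l \<times> Eminus L (l + 1).
                 src_plus L fp = u \<and> trm_plus L fp = trm_minus L fm \<and> src_minus L fm = v}
              {(em, ep) \<in> Eminus L l \<times> Eplus L (l + 1).
                 trm_minus L em = u \<and> src_minus L em = src_plus L ep \<and> trm_plus L ep = v}
          \<and> (\<forall>fp \<in> Eplus L l. \<forall>fm \<in> Eminus L (l + 1). \<forall>em ep.
               src_plus L fp = u \<and> trm_plus L fp = trm_minus L fm \<and> src_minus L fm = v \<and>
               \<phi> (fp, fm) = (em, ep)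
               \<longrightarrow> lab_plus L fp = lab_plus L ep \<and> lab_minus L fm = lab_minus L em)"

text \<open>
  The words \<open>F(v)\<close> and \<open>P(v)\<close> for a vertex \<open>v\<close> of level \<open>l\<close>.  An edge path is a function
  \<open>e\<close> whose values at \<open>1, \<dots>, l\<close> are the edges \<open>e\<^sub>1, \<dots>, e\<^sub>l\<close>, where \<open>e\<^sub>n\<close> joins the
  levels \<open>n - 1\<close> and \<open>n\<close>.  For \<open>l = 0\<close> both sets consist of the empty word only.
\<close>

definition follower_words :: "('v, 'm, 'p, 'a) bisystem \<Rightarrow> nat \<Rightarrow> 'v \<Rightarrow> 'a list set" where
  "follower_words L l v =
    {map (\<lambda>n. lab_minus L (e n)) (rev [1..<Suc l]) | e.
       (\<forall>n \<in> {1..l}. e n \<in> Eminus L (n - 1)) \<and>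
       (0 < l \<longrightarrow> src_minus L (e l) = v) \<and>
       (\<forall>n \<in> {2..l}. trm_minus L (e n) = src_minus L (e (n - 1)))}"

definition predecessor_words :: "('v, 'm, 'p, 'a) bisystem \<Rightarrow> nat \<Rightarrow> 'v \<Rightarrow> 'a list set" where
  "predecessor_words L l v =
    {map (\<lambda>n. lab_plus L (e n)) [1..<Suc l] | e.
       (\<forall>n \<in> {1..l}. e n \<in> Eplus L (n - 1)) \<and>
       (0 < l \<longrightarrow> trm_plus L (e l) = v) \<and>
       (\<forall>n \<in> {2..l}. src_plus L (e n) = trm_plus L (e (n - 1)))}"

definition FPCC :: "('v, 'm, 'p, 'a) bisystem \<Rightarrow> bool" where
  "FPCC L \<longleftrightarrow> (\<forall>l. \<forall>v \<in> Vert L l. follower_words L l v = predecessor_words L l v)"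


section \<open>The configuration space\<close>

text \<open>
  A configuration assigns to \<open>(k, l)\<close> with \<open>k < l\<close> the triple
  \<open>(v\<^bsub>(k,l)\<^esub>, e\<^sup>-\<^bsub>(k-1,k),l\<^esub>, e\<^sup>+\<^bsub>k,(l,l+1)\<^esub>)\<close>.
  Configurations are extensional functions, so that they carry no information outside
  the index set.
\<close>

type_synonym ('v, 'm, 'p) config = "int \<times> int \<Rightarrow> 'v \<times> 'm \<times> 'p"

definition Z2lt :: "(int \<times> int) set" where
  "Z2lt = {(k, l). k < l}"

definition level :: "int \<Rightarrow> int \<Rightarrow> nat" where
  "level k l = nat (l - k - 1)"

definition vtx :: "('v, 'm, 'p) config \<Rightarrow> int \<Rightarrow> int \<Rightarrow> 'v" where
  "vtx x k l = fst (x (k, l))"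

definition edge_minus :: "('v, 'm, 'p) config \<Rightarrow> int \<Rightarrow> int \<Rightarrow> 'm" where
  "edge_minus x k l = fst (snd (x (k, l)))"

definition edge_plus :: "('v, 'm, 'p) config \<Rightarrow> int \<Rightarrow> int \<Rightarrow> 'p" where
  "edge_plus x k l = snd (snd (x (k, l)))"

definition has_labels ::
    "('v, 'm, 'p, 'a) bisystem \<Rightarrow> ('v, 'm, 'p) config \<Rightarrow> (int \<Rightarrow> 'a) \<Rightarrow> bool" where
  "has_labels L x \<xi> \<longleftrightarrow> (\<forall>(k, l) \<in> Z2lt.
     lab_minus L (edge_minus x k l) = \<xi> k \<and> lab_plus L (edge_plus x k l) = \<xi> l)"

definition config_space ::
    "'a set \<Rightarrow> ('v, 'm, 'p, 'a) bisystem \<Rightarrow> ('v, 'm, 'p) config set" where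
  "config_space \<Sigma> L =
    {x \<in> (\<Pi>\<^sub>E (k, l) \<in> Z2lt. Vert L (level k l) \<times> Eminus L (level k l) \<times> Eplus L (level k l)).
       (\<forall>(k, l) \<in> Z2lt.
          src_minus L (edge_minus x k l) = vtx x (k - 1) l \<and>
          trm_minus L (edge_minus x k l) = vtx x k l \<and>
          src_plus L (edge_plus x k l) = vtx x k l \<and>
          trm_plus L (edge_plus x k l) = vtx x k (l + 1)) \<and>
       (\<exists>\<xi>. range \<xi> \<subseteq> \<Sigma> \<and> has_labels L x \<xi>)}"

text \<open>
  The set \<open>U\<^bsub>(\<mu>;v)\<^esub>\<close> for \<open>v\<close> at position \<open>(p, q)\<close>; the label sequence \<open>\<xi>\<close> of a
  configuration is unique.
\<close>

definition basic_open ::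
    "'a set \<Rightarrow> ('v, 'm, 'p, 'a) bisystem \<Rightarrow> int \<Rightarrow> int \<Rightarrow> 'a list \<Rightarrow> 'v \<Rightarrow> ('v, 'm, 'p) config set"
  where
  "basic_open \<Sigma> L p q \<mu> v =
    {x \<in> config_space \<Sigma> L. vtx x p q = v \<and> (\<exists>\<xi>. has_labels L x \<xi> \<and> map \<xi> [p + 1..q - 1] = \<mu>)}"

definition config_topology ::
    "'a set \<Rightarrow> ('v, 'm, 'p, 'a) bisystem \<Rightarrow> ('v, 'm, 'p) config topology" where
  "config_topology \<Sigma> L = topology_generated_by
    {basic_open \<Sigma> L p q \<mu> v | p q \<mu> v.
       (p, q) \<in> Z2lt \<and> v \<in> Vert L (level p q) \<and> \<mu> \<in> predecessor_words L (level p q) v}"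


section \<open>The equivalence relation and its inductive limit topology\<close>

definition square :: "int \<times> int \<Rightarrow> ('v, 'm, 'p) config \<Rightarrow> ('v, 'm, 'p) config" where
  "square = (\<lambda>(p, q) x. restrict x ({..p} \<times> {q..}))"

definition square_rel ::
    "'a set \<Rightarrow> ('v, 'm, 'p, 'a) bisystem \<Rightarrow> int \<times> int \<Rightarrow>
     (('v, 'm, 'p) config \<times> ('v, 'm, 'p) config) set" where
  "square_rel \<Sigma> L pq =
    {(x, z) \<in> config_space \<Sigma> L \<times> config_space \<Sigma> L. square pq x = square pq z}"

definition square_rel_topology ::
    "'a set \<Rightarrow> ('v, 'm, 'p, 'a) bisystem \<Rightarrow> int \<times> int \<Rightarrow>
     (('v, 'm, 'p) config \<times> ('v, 'm, 'p) config) topology" where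
  "square_rel_topology \<Sigma> L pq =
    subtopology (prod_topology (config_topology \<Sigma> L) (config_topology \<Sigma> L)) (square_rel \<Sigma> L pq)"

definition tail_rel ::
    "'a set \<Rightarrow> ('v, 'm, 'p, 'a) bisystem \<Rightarrow> (('v, 'm, 'p) config \<times> ('v, 'm, 'p) config) set" where
  "tail_rel \<Sigma> L = (\<Union>pq \<in> Z2lt. square_rel \<Sigma> L pq)"

text \<open>The final topology on a union of spaces with respect to the inclusion maps.\<close>

definition inductive_limit_topology :: "'i set \<Rightarrow> ('i \<Rightarrow> 'b topology) \<Rightarrow> 'b topology" where
  "inductive_limit_topology I T = topology (\<lambda>U.
     U \<subseteq> (\<Union>i \<in> I. topspace (T i)) \<and> (\<forall>i \<in> I. openin (T i) (U \<inter> topspace (T i))))"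

lemma openin_inductive_limit_topology:
  fixes T :: "'i \<Rightarrow> 'b topology"
  shows "openin (inductive_limit_topology I T) U \<longleftrightarrow>
     U \<subseteq> (\<Union>i \<in> I. topspace (T i)) \<and> (\<forall>i \<in> I. openin (T i) (U \<inter> topspace (T i)))"
proof -
  have inter: "openin X (S \<inter> S' \<inter> topspace X)"
    if "openin X (S \<inter> topspace X)" "openin X (S' \<inter> topspace X)" for X :: "'b topology" and S S'
  proof -
    have "S \<inter> S' \<inter> topspace X = (S \<inter> topspace X) \<inter> (S' \<inter> topspace X)"
      by auto
    then show ?thesis
      using that by (metis openin_Int)
  qed
  have union: "openin X (\<Union>\<K> \<inter> topspace X)"
    if "\<And>K. K \<in> \<K> \<Longrightarrow> openin X (K \<inter> topspace X)" for X :: "'b topology" and \<K>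
  proof -
    have "\<Union>\<K> \<inter> topspace X = (\<Union>K\<in>\<K>. K \<inter> topspace X)"
      by auto
    then show ?thesis
      using that by (metis (no_types, lifting) imageE openin_Union)
  qed
  have "istopology (\<lambda>U. U \<subseteq> (\<Union>i \<in> I. topspace (T i)) \<and>
          (\<forall>i \<in> I. openin (T i) (U \<inter> topspace (T i))))"
    unfolding istopology_def
    apply (intro conjI allI impI ballI)
       apply blast
      apply (rule inter; blast)
     apply blast
    apply (rule union; blast)
    done
  then show ?thesis
    by (simp add: inductive_limit_topology_def topology_inverse')
qed

definition tail_rel_topology ::
    "'a set \<Rightarrow> ('v, 'm, 'p, 'a) bisystem \<Rightarrow>
     (('v, 'm, 'p) config \<times> ('v, 'm, 'p) config) topology" where
  "tail_rel_topology \<Sigma> L = inductive_limit_topology Z2lt (square_rel_topology \<Sigma> L)"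


section \<open>Etale and AF equivalence relations\<close>

definition local_homeomorphism :: "'b topology \<Rightarrow> 'c topology \<Rightarrow> ('b \<Rightarrow> 'c) \<Rightarrow> bool" where
  "local_homeomorphism X Y f \<longleftrightarrow> (\<forall>x \<in> topspace X. \<exists>U. openin X U \<and> x \<in> U \<and> openin Y (f ` U) \<and>
     homeomorphic_map (subtopology X U) (subtopology Y (f ` U)) f)"

text \<open>
  An equivalence relation \<open>R\<close> on \<open>X\<close> is regarded as a groupoid with unit space \<open>X\<close>,
  product \<open>(x, y)(y, z) = (x, z)\<close> and inverse \<open>(x, y)\<^sup>-\<^sup>1 = (y, x)\<close>; the composable pairs
  carry the topology induced from the product of \<open>T\<close> with itself.
\<close>

definition topological_groupoid_relation ::
    "'b topology \<Rightarrow> ('b \<times> 'b) set \<Rightarrow> ('b \<times> 'b) topology \<Rightarrow> bool" where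
  "topological_groupoid_relation X R T \<longleftrightarrow>
     equiv (topspace X) R \<and> topspace T = R \<and>
     continuous_map T X fst \<and> continuous_map T X snd \<and>
     continuous_map X T (\<lambda>x. (x, x)) \<and>
     continuous_map T T (\<lambda>(x, y). (y, x)) \<and>
     continuous_map (subtopology (prod_topology T T) {(g, h). snd g = fst h}) T
       (\<lambda>(g, h). (fst g, snd h))"

definition etale_equivalence_relation ::
    "'b topology \<Rightarrow> ('b \<times> 'b) set \<Rightarrow> ('b \<times> 'b) topology \<Rightarrow> bool" where
  "etale_equivalence_relation X R T \<longleftrightarrow>
     compact_space X \<and> metrizable_space X \<and>
     topological_groupoid_relation X R T \<and>
     local_homeomorphism T X fst \<and> local_homeomorphism T X snd"

definition totally_disconnected_space :: "'b topology \<Rightarrow> bool" where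
  "totally_disconnected_space X \<longleftrightarrow> (\<forall>S. connectedin X S \<longrightarrow> (\<exists>a. S \<subseteq> {a}))"

definition AF_equivalence_relation ::
    "'b topology \<Rightarrow> ('b \<times> 'b) set \<Rightarrow> ('b \<times> 'b) topology \<Rightarrow> bool" where
  "AF_equivalence_relation X R T \<longleftrightarrow>
     etale_equivalence_relation X R T \<and> totally_disconnected_space X \<and>
     (\<exists>K :: nat \<Rightarrow> ('b \<times> 'b) set.
        (\<forall>n. equiv (topspace X) (K n) \<and> K n \<subseteq> K (Suc n) \<and> compactin T (K n) \<and> openin T (K n)) \<and>
        R = (\<Union>n. K n))"

end

theory Submission
  imports Defs
begin

text \<open>
  Read every edge as a deterministic move that lowers the level: downward edges forwards,
  upward edges backwards.  The local property makes these two kinds of moves commute, so a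
  vertex at \<open>(K, M)\<close> together with the labels read on the way determines all entries of a
  configuration at positions \<open>(k, l)\<close> with \<open>K < k < l < M\<close> (\<open>entry_eqI\<close>).
  Consequently entries are locally constant for the topology of basic open sets, and this
  topology is the one induced from the product of the finite discrete sets of entries
  (\<open>config_topology_eq\<close>).  The defining conditions of a configuration are local, so the
  configuration space is closed in this product: it is compact, metrizable and totally
  disconnected.

  The relation of agreement on the square at \<open>(p, q)\<close> is one stage of the inductive limit.
  It is a closed equivalence relation, hence compact.
  It is also open in the inductive limit (\<open>openin_T_square_rel\<close>).  Indeed, take two
  configurations that agree on a smaller square and are close to a pair agreeing on the
  square at \<open>(p, q)\<close>: their labels agree outside the interval between \<open>p\<close> and \<open>q\<close>, and by
  determinism so do all entries of the larger square.  The AF property and the continuity of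
  the groupoid operations follow from these two facts.

  FPCC is what makes the projections open.  If \<open>x\<close> and \<open>z\<close> agree on the square at \<open>(p, q)\<close>,
  they have the same vertex \<open>v\<close> there; let \<open>\<mu>\<close> and \<open>\<nu>\<close> be the words which they carry
  between \<open>p\<close> and \<open>q\<close>.  By determinism \<open>z\<close> is given by \<open>x\<close> and \<open>\<nu>\<close>.  Every other configuration with vertex \<open>v\<close> and word
  \<open>\<mu>\<close> can have its word replaced by \<open>\<nu>\<close> (\<open>replace_word\<close>): FPCC guarantees that the
  new word, which is readable by upward edges, is also readable by downward edges, and
  conversely, so that the square can be completed to a configuration.  The pairs obtained in
  this way form a compact open set on which both projections are injective with open images
  (\<open>compact_open_bisection\<close>), and continuous injections of compact sets into Hausdorff
  spaces are homeomorphisms onto their images.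
\<close>

section \<open>Deterministic moves\<close>

text \<open>
  Both kinds of edges are read as deterministic moves that lower the level by one: a
  downward edge is followed from its source, an upward edge backwards from its terminal
  vertex.  With this orientation right- and left-resolving both say that the current vertex
  and the label determine the next vertex.
\<close>

definition minus_step :: "('v, 'm, 'p, 'a) bisystem \<Rightarrow> nat \<Rightarrow> 'v \<Rightarrow> 'a \<Rightarrow> 'v \<Rightarrow> bool" where
  "minus_step L n v a w \<longleftrightarrow>
     (\<exists>e \<in> Eminus L n. src_minus L e = v \<and> lab_minus L e = a \<and> trm_minus L e = w)"

definition plus_step :: "('v, 'm, 'p, 'a) bisystem \<Rightarrow> nat \<Rightarrow> 'v \<Rightarrow> 'a \<Rightarrow> 'v \<Rightarrow> bool" where
  "plus_step L n v a w \<longleftrightarrow>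
     (\<exists>e \<in> Eplus L n. trm_plus L e = v \<and> lab_plus L e = a \<and> src_plus L e = w)"

lemma predecessor_words_0: "predecessor_words L 0 v = {[]}"
  by (auto simp: predecessor_words_def)

text \<open>
  Follower words are consumed from the left by downward edges, predecessor words (below)
  from the right by upward edges.  FPCC therefore says that a word readable in one
  direction is readable in the other.
\<close>

lemma follower_words_Suc:
  "follower_words L (Suc n) v =
     {a # w | a w. \<exists>u. minus_step L n v a u \<and> w \<in> follower_words L n u}"
proof (intro subset_antisym subsetI)
  fix w assume "w \<in> follower_words L (Suc n) v"
  then obtain e where w: "w = map (\<lambda>n. lab_minus L (e n)) (rev [1..<Suc (Suc n)])"
    and e: "\<forall>i \<in> {1..Suc n}. e i \<in> Eminus L (i - 1)" "src_minus L (e (Suc n)) = v"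
      "\<forall>i \<in> {2..Suc n}. trm_minus L (e i) = src_minus L (e (i - 1))"
    unfolding follower_words_def by blast
  let ?w = "map (\<lambda>n. lab_minus L (e n)) (rev [1..<Suc n])"
  have "0 < n \<longrightarrow> src_minus L (e n) = trm_minus L (e (Suc n))"
    using e(3) by (auto dest: bspec[of _ _ "Suc n"])
  then have "?w \<in> follower_words L n (trm_minus L (e (Suc n)))"
    unfolding follower_words_def using e by (intro CollectI exI[of _ e]) auto
  moreover have "minus_step L n v (lab_minus L (e (Suc n))) (trm_minus L (e (Suc n)))"
    unfolding minus_step_def using e by (intro bexI[of _ "e (Suc n)"]) (auto dest: bspec[of _ _ "Suc n"])
  ultimately show "w \<in> {a # w | a w. \<exists>u. minus_step L n v a u \<and> w \<in> follower_words L n u}"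
    using w by auto
next
  fix w assume "w \<in> {a # w | a w. \<exists>u. minus_step L n v a u \<and> w \<in> follower_words L n u}"
  then obtain a w' u where w: "w = a # w'" "minus_step L n v a u" "w' \<in> follower_words L n u"
    by blast
  then obtain f where f: "f \<in> Eminus L n" "src_minus L f = v" "lab_minus L f = a" "trm_minus L f = u"
    unfolding minus_step_def by blast
  obtain e where w': "w' = map (\<lambda>n. lab_minus L (e n)) (rev [1..<Suc n])"
    and e: "\<forall>i \<in> {1..n}. e i \<in> Eminus L (i - 1)" "0 < n \<longrightarrow> src_minus L (e n) = u"
      "\<forall>i \<in> {2..n}. trm_minus L (e i) = src_minus L (e (i - 1))"
    using w(3) unfolding follower_words_def by blast
  define e' where "e' = e(Suc n := f)"
  have "map (\<lambda>n. lab_minus L (e' n)) (rev [1..<Suc n]) = w'"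
    unfolding w' by (rule map_cong) (auto simp: e'_def)
  then have "w = map (\<lambda>n. lab_minus L (e' n)) (rev [1..<Suc (Suc n)])"
    using w(1) f by (simp add: e'_def)
  moreover have "\<forall>i \<in> {1..Suc n}. e' i \<in> Eminus L (i - 1)"
    using e f by (auto simp: e'_def le_Suc_eq)
  moreover have "\<forall>i \<in> {2..Suc n}. trm_minus L (e' i) = src_minus L (e' (i - 1))"
    using e f by (auto simp: e'_def le_Suc_eq)
  moreover have "src_minus L (e' (Suc n)) = v"
    using f by (simp add: e'_def)
  ultimately show "w \<in> follower_words L (Suc n) v"
    unfolding follower_words_def by blast
qed

lemma predecessor_words_Suc:
  "predecessor_words L (Suc n) v =
     {w @ [a] | a w. \<exists>u. plus_step L n v a u \<and> w \<in> predecessor_words L n u}"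
proof (intro subset_antisym subsetI)
  fix w assume "w \<in> predecessor_words L (Suc n) v"
  then obtain e where w: "w = map (\<lambda>n. lab_plus L (e n)) [1..<Suc (Suc n)]"
    and e: "\<forall>i \<in> {1..Suc n}. e i \<in> Eplus L (i - 1)" "trm_plus L (e (Suc n)) = v"
      "\<forall>i \<in> {2..Suc n}. src_plus L (e i) = trm_plus L (e (i - 1))"
    unfolding predecessor_words_def by blast
  let ?w = "map (\<lambda>n. lab_plus L (e n)) [1..<Suc n]"
  have "0 < n \<longrightarrow> trm_plus L (e n) = src_plus L (e (Suc n))"
    using e(3) by (auto dest: bspec[of _ _ "Suc n"])
  then have "?w \<in> predecessor_words L n (src_plus L (e (Suc n)))"
    unfolding predecessor_words_def using e by (intro CollectI exI[of _ e]) auto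
  moreover have "plus_step L n v (lab_plus L (e (Suc n))) (src_plus L (e (Suc n)))"
    unfolding plus_step_def using e by (intro bexI[of _ "e (Suc n)"]) (auto dest: bspec[of _ _ "Suc n"])
  ultimately show "w \<in> {w @ [a] | a w. \<exists>u. plus_step L n v a u \<and> w \<in> predecessor_words L n u}"
    using w by auto
next
  fix w assume "w \<in> {w @ [a] | a w. \<exists>u. plus_step L n v a u \<and> w \<in> predecessor_words L n u}"
  then obtain a w' u where w: "w = w' @ [a]" "plus_step L n v a u" "w' \<in> predecessor_words L n u"
    by blast
  then obtain f where f: "f \<in> Eplus L n" "trm_plus L f = v" "lab_plus L f = a" "src_plus L f = u"
    unfolding plus_step_def by blast
  obtain e where w': "w' = map (\<lambda>n. lab_plus L (e n)) [1..<Suc n]"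
    and e: "\<forall>i \<in> {1..n}. e i \<in> Eplus L (i - 1)" "0 < n \<longrightarrow> trm_plus L (e n) = u"
      "\<forall>i \<in> {2..n}. src_plus L (e i) = trm_plus L (e (i - 1))"
    using w(3) unfolding predecessor_words_def by blast
  define e' where "e' = e(Suc n := f)"
  have "map (\<lambda>n. lab_plus L (e' n)) [1..<Suc n] = w'"
    unfolding w' by (rule map_cong) (auto simp: e'_def)
  then have "w = map (\<lambda>n. lab_plus L (e' n)) [1..<Suc (Suc n)]"
    using w(1) f by (simp add: e'_def)
  moreover have "\<forall>i \<in> {1..Suc n}. e' i \<in> Eplus L (i - 1)"
    using e f by (auto simp: e'_def le_Suc_eq)
  moreover have "\<forall>i \<in> {2..Suc n}. src_plus L (e' i) = trm_plus L (e' (i - 1))"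
    using e f by (auto simp: e'_def le_Suc_eq)
  moreover have "trm_plus L (e' (Suc n)) = v"
    using f by (simp add: e'_def)
  ultimately show "w \<in> predecessor_words L (Suc n) v"
    unfolding predecessor_words_def by blast
qed

lemma level_pred: "k < l \<Longrightarrow> level (k - 1) l = Suc (level k l)"
  by (simp add: level_def)

lemma level_succ: "k < l \<Longrightarrow> level k (l + 1) = Suc (level k l)"
  by (simp add: level_def)

context lambda_graph_bisystem
begin

lemma minus_step_unique:
  "minus_step L n v a w \<Longrightarrow> minus_step L n v a w' \<Longrightarrow> w = w'"
  unfolding minus_step_def using right_resolving by metis

lemma plus_step_unique:
  "plus_step L n v a w \<Longrightarrow> plus_step L n v a w' \<Longrightarrow> w = w'"
  unfolding plus_step_def using left_resolving by metis

lemma minus_step_Vert: "minus_step L n v a w \<Longrightarrow> v \<in> Vert L (Suc n) \<and> w \<in> Vert L n \<and> a \<in> \<Sigma>"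
  unfolding minus_step_def using src_minus trm_minus lab_minus by fastforce

lemma plus_step_Vert: "plus_step L n v a w \<Longrightarrow> v \<in> Vert L (Suc n) \<and> w \<in> Vert L n \<and> a \<in> \<Sigma>"
  unfolding plus_step_def using src_plus trm_plus lab_plus by fastforce

text \<open>
  The two halves of the local property, in terms of moves: the bijection \<open>\<phi>\<close> completes a
  path around one corner of a unit square to a path around the opposite corner with the
  same labels, and its inverse does the converse.
\<close>

lemma minus_plus_commute:
  assumes "minus_step L (Suc n) v a w" "plus_step L n w b u"
  shows "\<exists>w'. plus_step L (Suc n) v b w' \<and> minus_step L n w' a u"
proof -
  obtain fm where fm: "fm \<in> Eminus L (n + 1)" "src_minus L fm = v" "lab_minus L fm = a" "trm_minus L fm = w"
    using assms(1) unfolding minus_step_def by auto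
  obtain fp where fp: "fp \<in> Eplus L n" "trm_plus L fp = w" "lab_plus L fp = b" "src_plus L fp = u"
    using assms(2) unfolding plus_step_def by auto
  have "u \<in> Vert L n" "v \<in> Vert L (n + 2)"
    using plus_step_Vert[OF assms(2)] minus_step_Vert[OF assms(1)] by auto
  from local_property[OF this] obtain \<phi> where
    bij: "bij_betw \<phi>
              {(fp, fm) \<in> Eplus L n \<times> Eminus L (n + 1).
                 src_plus L fp = u \<and> trm_plus L fp = trm_minus L fm \<and> src_minus L fm = v}
              {(em, ep) \<in> Eminus L n \<times> Eplus L (n + 1).
                 trm_minus L em = u \<and> src_minus L em = src_plus L ep \<and> trm_plus L ep = v}"
    and lab: "\<forall>fp \<in> Eplus L n. \<forall>fm \<in> Eminus L (n + 1). \<forall>em ep.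
               src_plus L fp = u \<and> trm_plus L fp = trm_minus L fm \<and> src_minus L fm = v \<and>
               \<phi> (fp, fm) = (em, ep)
               \<longrightarrow> lab_plus L fp = lab_plus L ep \<and> lab_minus L fm = lab_minus L em"
    by blast
  obtain em ep where \<phi>: "\<phi> (fp, fm) = (em, ep)"
    by fastforce
  have "(em, ep) \<in> {(em, ep) \<in> Eminus L n \<times> Eplus L (n + 1).
                 trm_minus L em = u \<and> src_minus L em = src_plus L ep \<and> trm_plus L ep = v}"
    unfolding \<phi>[symmetric] using fm fp by (intro bij_betw_apply[OF bij]) auto
  moreover have "lab_plus L ep = b" "lab_minus L em = a"
    using lab fm fp \<phi> by metis+
  ultimately have "plus_step L (Suc n) v b (src_plus L ep)" "minus_step L n (src_plus L ep) a u"
    unfolding plus_step_def minus_step_def by auto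
  then show ?thesis by blast
qed

lemma plus_minus_commute:
  assumes "plus_step L (Suc n) v b w" "minus_step L n w a u"
  shows "\<exists>w'. minus_step L (Suc n) v a w' \<and> plus_step L n w' b u"
proof -
  obtain em where em: "em \<in> Eminus L n" "src_minus L em = w" "lab_minus L em = a" "trm_minus L em = u"
    using assms(2) unfolding minus_step_def by auto
  obtain ep where ep: "ep \<in> Eplus L (n + 1)" "trm_plus L ep = v" "lab_plus L ep = b" "src_plus L ep = w"
    using assms(1) unfolding plus_step_def by auto
  have "u \<in> Vert L n" "v \<in> Vert L (n + 2)"
    using plus_step_Vert[OF assms(1)] minus_step_Vert[OF assms(2)] by auto
  from local_property[OF this] obtain \<phi> where
    bij: "bij_betw \<phi>
              {(fp, fm) \<in> Eplus L n \<times> Eminus L (n + 1).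
                 src_plus L fp = u \<and> trm_plus L fp = trm_minus L fm \<and> src_minus L fm = v}
              {(em, ep) \<in> Eminus L n \<times> Eplus L (n + 1).
                 trm_minus L em = u \<and> src_minus L em = src_plus L ep \<and> trm_plus L ep = v}"
      (is "bij_betw _ ?A ?B")
    and lab: "\<forall>fp \<in> Eplus L n. \<forall>fm \<in> Eminus L (n + 1). \<forall>em ep.
               src_plus L fp = u \<and> trm_plus L fp = trm_minus L fm \<and> src_minus L fm = v \<and>
               \<phi> (fp, fm) = (em, ep)
               \<longrightarrow> lab_plus L fp = lab_plus L ep \<and> lab_minus L fm = lab_minus L em"
    by blast
  have "(em, ep) \<in> ?B"
    using em ep by auto
  then have "(em, ep) \<in> \<phi> ` ?A"
    using bij by (simp add: bij_betw_def)
  then obtain fp fm where f: "\<phi> (fp, fm) = (em, ep)" "fp \<in> Eplus L n" "fm \<in> Eminus L (n + 1)"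
      "src_plus L fp = u" "trm_plus L fp = trm_minus L fm" "src_minus L fm = v"
    by auto
  then have "lab_plus L fp = b" "lab_minus L fm = a"
    using lab em ep by metis+
  then have "minus_step L (Suc n) v a (trm_plus L fp)" "plus_step L n (trm_plus L fp) b u"
    using f unfolding plus_step_def minus_step_def by auto
  then show ?thesis by blast
qed

lemma config_entry:
  assumes "x \<in> config_space \<Sigma> L" "k < l"
  shows "vtx x k l \<in> Vert L (level k l)"
    and "edge_minus x k l \<in> Eminus L (level k l)"
    and "edge_plus x k l \<in> Eplus L (level k l)"
    and "src_minus L (edge_minus x k l) = vtx x (k - 1) l"
    and "trm_minus L (edge_minus x k l) = vtx x k l"
    and "src_plus L (edge_plus x k l) = vtx x k l"
    and "trm_plus L (edge_plus x k l) = vtx x k (l + 1)"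
proof -
  have kl: "(k, l) \<in> Z2lt"
    using assms(2) by (simp add: Z2lt_def)
  have "x \<in> (\<Pi>\<^sub>E (k, l) \<in> Z2lt. Vert L (level k l) \<times> Eminus L (level k l) \<times> Eplus L (level k l))"
    using assms(1) by (simp add: config_space_def)
  from PiE_mem[OF this kl]
  show "vtx x k l \<in> Vert L (level k l)"
    and "edge_minus x k l \<in> Eminus L (level k l)"
    and "edge_plus x k l \<in> Eplus L (level k l)"
    by (auto simp: vtx_def edge_minus_def edge_plus_def)
  have "\<forall>(k, l) \<in> Z2lt.
          src_minus L (edge_minus x k l) = vtx x (k - 1) l \<and>
          trm_minus L (edge_minus x k l) = vtx x k l \<and>
          src_plus L (edge_plus x k l) = vtx x k l \<and>
          trm_plus L (edge_plus x k l) = vtx x k (l + 1)"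
    using assms(1) by (simp add: config_space_def)
  from bspec[OF this kl]
  show "src_minus L (edge_minus x k l) = vtx x (k - 1) l"
    and "trm_minus L (edge_minus x k l) = vtx x k l"
    and "src_plus L (edge_plus x k l) = vtx x k l"
    and "trm_plus L (edge_plus x k l) = vtx x k (l + 1)"
    by simp_all
qed

lemma has_labelsD:
  assumes "has_labels L x \<xi>" "k < l"
  shows "lab_minus L (edge_minus x k l) = \<xi> k" and "lab_plus L (edge_plus x k l) = \<xi> l"
  using assms by (auto simp: has_labels_def Z2lt_def)

lemma config_minus_step:
  assumes "x \<in> config_space \<Sigma> L" "has_labels L x \<xi>" "k < l"
  shows "minus_step L (level k l) (vtx x (k - 1) l) (\<xi> k) (vtx x k l)"
  unfolding minus_step_def
  by (rule bexI[of _ "edge_minus x k l"]) (simp_all add: config_entry has_labelsD assms)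

lemma config_plus_step:
  assumes "x \<in> config_space \<Sigma> L" "has_labels L x \<xi>" "k < l"
  shows "plus_step L (level k l) (vtx x k (l + 1)) (\<xi> l) (vtx x k l)"
  unfolding plus_step_def
  by (rule bexI[of _ "edge_plus x k l"]) (simp_all add: config_entry has_labelsD assms)

text \<open>
  From position \<open>(K, M)\<close> the vertex at \<open>(k, l)\<close> is reached by moving right along row \<open>M\<close>
  and then down column \<open>k\<close>.  Both moves are deterministic, so the starting vertex and the
  labels that are read determine the end.
\<close>

lemma vtx_eqI:
  assumes x: "x \<in> config_space \<Sigma> L" "has_labels L x \<xi>"
    and z: "z \<in> config_space \<Sigma> L" "has_labels L z \<zeta>"
    and eq: "vtx x K M = vtx z K M"
    and lab: "\<And>i. K < i \<Longrightarrow> i \<le> k \<Longrightarrow> \<xi> i = \<zeta> i" "\<And>i. l \<le> i \<Longrightarrow> i < M \<Longrightarrow> \<xi> i = \<zeta> i"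
    and kl: "K \<le> k" "k < l" "l \<le> M"
  shows "vtx x k l = vtx z k l"
proof -
  have "j \<le> k \<longrightarrow> vtx x j M = vtx z j M" if "K \<le> j" for j
    using that
  proof (induction j rule: int_ge_induct)
    case (step j)
    show ?case
    proof
      assume j: "j + 1 \<le> k"
      then have "minus_step L (level (j + 1) M) (vtx x j M) (\<xi> (j + 1)) (vtx x (j + 1) M)"
          "minus_step L (level (j + 1) M) (vtx z j M) (\<zeta> (j + 1)) (vtx z (j + 1) M)"
        using config_minus_step[OF x, of "j + 1" M] config_minus_step[OF z, of "j + 1" M] kl by auto
      moreover have "\<xi> (j + 1) = \<zeta> (j + 1)" "vtx x j M = vtx z j M"
        using lab(1)[of "j + 1"] step j by auto
      ultimately show "vtx x (j + 1) M = vtx z (j + 1) M"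
        using minus_step_unique by metis
    qed
  qed (use eq in simp)
  then have top: "vtx x k M = vtx z k M"
    using kl by simp
  have "l \<le> j \<longrightarrow> vtx x k j = vtx z k j" if "j \<le> M" for j
    using that
  proof (induction j rule: int_le_induct)
    case (step j)
    show ?case
    proof
      assume j: "l \<le> j - 1"
      then have "plus_step L (level k (j - 1)) (vtx x k j) (\<xi> (j - 1)) (vtx x k (j - 1))"
          "plus_step L (level k (j - 1)) (vtx z k j) (\<zeta> (j - 1)) (vtx z k (j - 1))"
        using config_plus_step[OF x, of k "j - 1"] config_plus_step[OF z, of k "j - 1"] kl by auto
      moreover have "\<xi> (j - 1) = \<zeta> (j - 1)" "vtx x k j = vtx z k j"
        using lab(2)[of "j - 1"] step j by auto
      ultimately show "vtx x k (j - 1) = vtx z k (j - 1)"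
        using plus_step_unique by metis
    qed
  qed (use top in simp)
  then show ?thesis
    using kl by simp
qed

text \<open>
  The two edges at \<open>(k, l)\<close> are determined by their label together with the vertex at
  \<open>(k - 1, l)\<close> and at \<open>(k, l + 1)\<close>; the strict inequalities put these two vertices into the
  range of the preceding lemma.
\<close>

lemma entry_eqI:
  assumes x: "x \<in> config_space \<Sigma> L" "has_labels L x \<xi>"
    and z: "z \<in> config_space \<Sigma> L" "has_labels L z \<zeta>"
    and eq: "vtx x K M = vtx z K M"
    and lab: "\<And>i. K < i \<Longrightarrow> i \<le> k \<Longrightarrow> \<xi> i = \<zeta> i" "\<And>i. l \<le> i \<Longrightarrow> i < M \<Longrightarrow> \<xi> i = \<zeta> i"
    and kl: "K < k" "k < l" "l < M"
  shows "x (k, l) = z (k, l)"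
proof -
  have v: "vtx x k l = vtx z k l" "vtx x (k - 1) l = vtx z (k - 1) l"
      "vtx x k (l + 1) = vtx z k (l + 1)"
    by (rule vtx_eqI[OF x z eq]; use lab kl in force)+
  have lab': "\<xi> k = \<zeta> k" "\<xi> l = \<zeta> l"
    using lab(1)[of k] lab(2)[of l] kl by auto
  have "edge_minus x k l = edge_minus z k l"
  proof (rule ccontr)
    assume "edge_minus x k l \<noteq> edge_minus z k l"
    from right_resolving[OF _ _ this] show False
      using config_entry[OF x(1) kl(2)] config_entry[OF z(1) kl(2)]
        has_labelsD[OF x(2) kl(2)] has_labelsD[OF z(2) kl(2)] v lab' by metis
  qed
  moreover have "edge_plus x k l = edge_plus z k l"
  proof (rule ccontr)
    assume "edge_plus x k l \<noteq> edge_plus z k l"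
    from left_resolving[OF _ _ this] show False
      using config_entry[OF x(1) kl(2)] config_entry[OF z(1) kl(2)]
        has_labelsD[OF x(2) kl(2)] has_labelsD[OF z(2) kl(2)] v lab' by metis
  qed
  ultimately show ?thesis
    using v(1) by (auto simp: vtx_def edge_minus_def edge_plus_def prod_eq_iff)
qed

section \<open>Replacing a word in a configuration\<close>

text \<open>
  A vertex at position \<open>(k, l)\<close> can be the corner of a configuration with labels \<open>\<xi>\<close>
  only if it reads the word of \<open>\<xi>\<close> strictly between \<open>k\<close> and \<open>l\<close>.
  This is the invariant that keeps the construction of a configuration from getting stuck.
\<close>

definition reads :: "(int \<Rightarrow> 'a) \<Rightarrow> int \<Rightarrow> int \<Rightarrow> 'v \<Rightarrow> bool" where
  "reads \<xi> k l v \<longleftrightarrow>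
     v \<in> Vert L (level k l) \<and> map \<xi> [k + 1..l - 1] \<in> follower_words L (level k l) v"

lemma reads_iff_minus_step:
  assumes "k < l"
  shows "reads \<xi> (k - 1) l v \<longleftrightarrow> (\<exists>w. minus_step L (level k l) v (\<xi> k) w \<and> reads \<xi> k l w)"
proof -
  have "map \<xi> [k - 1 + 1..l - 1] = \<xi> k # map \<xi> [k + 1..l - 1]"
    using assms by (simp add: upto_rec1)
  then show ?thesis
    using assms minus_step_Vert
    by (auto simp: reads_def level_pred follower_words_Suc)
qed

lemma reads_iff_predecessor_words:
  assumes "FPCC L"
  shows "reads \<xi> k l v \<longleftrightarrow>
     v \<in> Vert L (level k l) \<and> map \<xi> [k + 1..l - 1] \<in> predecessor_words L (level k l) v"
  using assms by (auto simp: reads_def FPCC_def)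

lemma reads_iff_plus_step:
  assumes "FPCC L" "k < l"
  shows "reads \<xi> k (l + 1) v \<longleftrightarrow> (\<exists>w. plus_step L (level k l) v (\<xi> l) w \<and> reads \<xi> k l w)"
proof -
  have "map \<xi> [k + 1..l + 1 - 1] = map \<xi> [k + 1..l - 1] @ [\<xi> l]"
    using assms by (simp add: upto_rec2)
  then show ?thesis
    using assms plus_step_Vert
    by (auto simp: reads_iff_predecessor_words level_succ predecessor_words_Suc)
qed

text \<open>
  A partial configuration on \<open>k \<le> p\<close>, \<open>q \<le> l\<close> is extended to all columns, one after the
  other.  Downward edges to the next column exist because its predecessor reads \<open>\<xi>\<close>; the
  upward edges inside the new column then come from the local property.
\<close>

lemma extend_columns:
  assumes minus: "\<And>k l. k \<le> p \<Longrightarrow> q \<le> l \<Longrightarrow> minus_step L (level k l) (y (k - 1) l) (\<xi> k) (y k l)"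
    and plus: "\<And>k l. k \<le> p \<Longrightarrow> q \<le> l \<Longrightarrow> plus_step L (level k l) (y k (l + 1)) (\<xi> l) (y k l)"
    and reads: "\<And>l. q \<le> l \<Longrightarrow> reads \<xi> p l (y p l)"
  shows "\<exists>c. (\<forall>k\<le>p. \<forall>l. c k l = y k l) \<and>
    (\<forall>k l. q \<le> l \<longrightarrow> k < l \<longrightarrow> minus_step L (level k l) (c (k - 1) l) (\<xi> k) (c k l)
       \<and> plus_step L (level k l) (c k (l + 1)) (\<xi> l) (c k l)) \<and>
    (\<forall>k l. q \<le> l \<longrightarrow> p \<le> k \<longrightarrow> k < l \<longrightarrow> reads \<xi> k l (c k l))"
proof -
  \<comment> \<open>the choice is unique where a move exists; at positions with \<open>k \<ge> l\<close> there are no vertices and the value is irrelevant\<close>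
  define f where "f l = rec_nat (y p l)
    (\<lambda>i v. SOME w. minus_step L (level (p + int i + 1) l) v (\<xi> (p + int i + 1)) w)" for l
  define c where "c k l = (if k \<le> p then y k l else f l (nat (k - p)))" for k l
  have c_base: "c k l = y k l" if "k \<le> p" for k l
    using that by (simp add: c_def)
  have c_step: "c (k + 1) l = (SOME w. minus_step L (level (k + 1) l) (c k l) (\<xi> (k + 1)) w)"
    if "p \<le> k" for k l
  proof -
    have "nat (k + 1 - p) = Suc (nat (k - p))" "p + int (nat (k - p)) + 1 = k + 1"
      using that by auto
    moreover have "c k l = f l (nat (k - p))"
      using that by (auto simp: c_def f_def)
    ultimately show ?thesis
      using that by (simp add: c_def f_def)
  qed
  have descend: "minus_step L (level (k + 1) l) (c k l) (\<xi> (k + 1)) (c (k + 1) l) \<and>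
      reads \<xi> (k + 1) l (c (k + 1) l)" if prem: "reads \<xi> k l (c k l)" "p \<le> k" "k + 1 < l" for k l
  proof -
    obtain w where w: "minus_step L (level (k + 1) l) (c k l) (\<xi> (k + 1)) w" "reads \<xi> (k + 1) l w"
      using reads_iff_minus_step[of "k + 1" l \<xi> "c k l"] prem by auto
    have "minus_step L (level (k + 1) l) (c k l) (\<xi> (k + 1)) (c (k + 1) l)"
      unfolding c_step[OF prem(2)] using w(1) by (rule someI)
    then show ?thesis
      using minus_step_unique w by metis
  qed
  have c_reads: "q \<le> l \<longrightarrow> k < l \<longrightarrow> reads \<xi> k l (c k l)" if "p \<le> k" for k l
    using that
  proof (induction k rule: int_ge_induct)
    case base
    then show ?case
      using reads by (simp add: c_base)
  next
    case (step k)
    then show ?case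
      using descend[of k l] by auto
  qed
  have c_minus: "minus_step L (level k l) (c (k - 1) l) (\<xi> k) (c k l)" if "q \<le> l" "k < l" for k l
  proof (cases "k \<le> p")
    case True
    then show ?thesis
      using minus that by (simp add: c_base)
  next
    case False
    then show ?thesis
      using descend[of "k - 1" l] c_reads[of "k - 1" l] that by simp
  qed
  have c_plus: "q \<le> l \<longrightarrow> k < l \<longrightarrow> plus_step L (level k l) (c k (l + 1)) (\<xi> l) (c k l)"
    if "p \<le> k" for k l
    using that
  proof (induction k rule: int_ge_induct)
    case base
    then show ?case
      using plus by (simp add: c_base)
  next
    case (step k)
    show ?case
    proof (intro impI)
      assume l: "q \<le> l" "k + 1 < l"
      have lev: "level k l = Suc (level (k + 1) l)" "level (k + 1) (l + 1) = Suc (level (k + 1) l)"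
        using l level_pred[of "k + 1" l] level_succ[of "k + 1" l] by auto
      have "plus_step L (Suc (level (k + 1) l)) (c k (l + 1)) (\<xi> l) (c k l)"
        using step l lev by auto
      moreover have "minus_step L (level (k + 1) l) (c k l) (\<xi> (k + 1)) (c (k + 1) l)"
        using c_minus[of l "k + 1"] l by simp
      ultimately obtain w where w: "minus_step L (Suc (level (k + 1) l)) (c k (l + 1)) (\<xi> (k + 1)) w"
          "plus_step L (level (k + 1) l) w (\<xi> l) (c (k + 1) l)"
        using plus_minus_commute by blast
      moreover have "minus_step L (Suc (level (k + 1) l)) (c k (l + 1)) (\<xi> (k + 1)) (c (k + 1) (l + 1))"
        using c_minus[of "l + 1" "k + 1"] l lev by simp
      ultimately show "plus_step L (level (k + 1) l) (c (k + 1) (l + 1)) (\<xi> l) (c (k + 1) l)"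
        using minus_step_unique by metis
    qed
  qed
  have "plus_step L (level k l) (c k (l + 1)) (\<xi> l) (c k l)" if "q \<le> l" "k < l" for k l
    using that plus c_plus by (cases "k \<le> p") (auto simp: c_base)
  then show ?thesis
    using c_base c_minus c_reads by (intro exI[of _ c]) blast
qed

text \<open>
  The dual extension, from the rows \<open>l \<ge> q\<close> to all rows.  The next row is reached by
  upward edges read backwards; these exist because by FPCC the vertices also read \<open>\<xi>\<close>
  from the right.
\<close>

lemma extend_rows:
  assumes fpcc: "FPCC L"
    and minus: "\<And>k l. q \<le> l \<Longrightarrow> k < l \<Longrightarrow> minus_step L (level k l) (c (k - 1) l) (\<xi> k) (c k l)"
    and plus: "\<And>k l. q \<le> l \<Longrightarrow> k < l \<Longrightarrow> plus_step L (level k l) (c k (l + 1)) (\<xi> l) (c k l)"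
    and reads: "\<And>k. k < q \<Longrightarrow> reads \<xi> k q (c k q)"
  shows "\<exists>d. (\<forall>k. \<forall>l\<ge>q. d k l = c k l) \<and>
    (\<forall>k l. k < l \<longrightarrow> minus_step L (level k l) (d (k - 1) l) (\<xi> k) (d k l)
       \<and> plus_step L (level k l) (d k (l + 1)) (\<xi> l) (d k l))"
proof -
  define f where "f k = rec_nat (c k q)
    (\<lambda>i v. SOME w. plus_step L (level k (q - int i - 1)) v (\<xi> (q - int i - 1)) w)" for k
  define d where "d k l = (if q \<le> l then c k l else f k (nat (q - l)))" for k l
  have d_base: "d k l = c k l" if "q \<le> l" for k l
    using that by (simp add: d_def)
  have d_step: "d k (l - 1) = (SOME w. plus_step L (level k (l - 1)) (d k l) (\<xi> (l - 1)) w)"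
    if "l \<le> q" for k l
  proof -
    have "nat (q - (l - 1)) = Suc (nat (q - l))" "q - int (nat (q - l)) - 1 = l - 1"
      using that by auto
    moreover have "d k l = f k (nat (q - l))"
      using that by (auto simp: d_def f_def)
    ultimately show ?thesis
      using that by (simp add: d_def f_def)
  qed
  have descend: "plus_step L (level k (l - 1)) (d k l) (\<xi> (l - 1)) (d k (l - 1)) \<and>
      reads \<xi> k (l - 1) (d k (l - 1))" if prem: "reads \<xi> k l (d k l)" "l \<le> q" "k < l - 1" for k l
  proof -
    obtain w where w: "plus_step L (level k (l - 1)) (d k l) (\<xi> (l - 1)) w" "reads \<xi> k (l - 1) w"
      using reads_iff_plus_step[OF fpcc, of k "l - 1" \<xi> "d k l"] prem by auto
    have "plus_step L (level k (l - 1)) (d k l) (\<xi> (l - 1)) (d k (l - 1))"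
      unfolding d_step[OF prem(2)] using w(1) by (rule someI)
    then show ?thesis
      using plus_step_unique w by metis
  qed
  have d_reads: "k < l \<longrightarrow> reads \<xi> k l (d k l)" if "l \<le> q" for k l
    using that
  proof (induction l rule: int_le_induct)
    case base
    then show ?case
      using reads by (simp add: d_base)
  next
    case (step l)
    then show ?case
      using descend[of k l] by auto
  qed
  have d_plus: "plus_step L (level k l) (d k (l + 1)) (\<xi> l) (d k l)" if "k < l" for k l
  proof (cases "q \<le> l")
    case True
    then show ?thesis
      using plus that by (simp add: d_base)
  next
    case False
    then show ?thesis
      using descend[of k "l + 1"] d_reads[of "l + 1" k] that by simp
  qed
  have d_minus: "k < l \<longrightarrow> minus_step L (level k l) (d (k - 1) l) (\<xi> k) (d k l)"
    if "l \<le> q" for k l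
    using that
  proof (induction l rule: int_le_induct)
    case base
    then show ?case
      using minus by (simp add: d_base)
  next
    case (step l)
    show ?case
    proof
      assume l: "k < l - 1"
      have lev: "level k l = Suc (level k (l - 1))" "level (k - 1) (l - 1) = Suc (level k (l - 1))"
        using l level_pred[of k "l - 1"] level_succ[of k "l - 1"] by auto
      have "minus_step L (Suc (level k (l - 1))) (d (k - 1) l) (\<xi> k) (d k l)"
        using step l lev by auto
      moreover have "plus_step L (level k (l - 1)) (d k l) (\<xi> (l - 1)) (d k (l - 1))"
        using d_plus[of k "l - 1"] l by simp
      ultimately obtain w where w: "plus_step L (Suc (level k (l - 1))) (d (k - 1) l) (\<xi> (l - 1)) w"
          "minus_step L (level k (l - 1)) w (\<xi> k) (d k (l - 1))"
        using minus_plus_commute by blast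
      moreover have "plus_step L (Suc (level k (l - 1))) (d (k - 1) l) (\<xi> (l - 1)) (d (k - 1) (l - 1))"
        using d_plus[of "k - 1" "l - 1"] l lev by simp
      ultimately show "minus_step L (level k (l - 1)) (d (k - 1) (l - 1)) (\<xi> k) (d k (l - 1))"
        using plus_step_unique by metis
    qed
  qed
  have "minus_step L (level k l) (d (k - 1) l) (\<xi> k) (d k l)" if "k < l" for k l
    using that minus d_minus by (cases "q \<le> l") (auto simp: d_base)
  then show ?thesis
    using d_base d_plus by (intro exI[of _ d]) blast
qed

lemma config_of_vertices:
  assumes minus: "\<And>k l. k < l \<Longrightarrow> minus_step L (level k l) (y (k - 1) l) (\<xi> k) (y k l)"
    and plus: "\<And>k l. k < l \<Longrightarrow> plus_step L (level k l) (y k (l + 1)) (\<xi> l) (y k l)"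
  shows "\<exists>z \<in> config_space \<Sigma> L. has_labels L z \<xi> \<and> (\<forall>k l. k < l \<longrightarrow> vtx z k l = y k l)"
proof -
  have "\<forall>k l. \<exists>e. k < l \<longrightarrow> e \<in> Eminus L (level k l) \<and> src_minus L e = y (k - 1) l \<and>
      lab_minus L e = \<xi> k \<and> trm_minus L e = y k l"
    using minus unfolding minus_step_def by blast
  then obtain em where em: "\<And>k l. k < l \<Longrightarrow> em k l \<in> Eminus L (level k l) \<and>
      src_minus L (em k l) = y (k - 1) l \<and> lab_minus L (em k l) = \<xi> k \<and> trm_minus L (em k l) = y k l"
    by metis
  have "\<forall>k l. \<exists>e. k < l \<longrightarrow> e \<in> Eplus L (level k l) \<and> trm_plus L e = y k (l + 1) \<and>
      lab_plus L e = \<xi> l \<and> src_plus L e = y k l"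
    using plus unfolding plus_step_def by blast
  then obtain ep where ep: "\<And>k l. k < l \<Longrightarrow> ep k l \<in> Eplus L (level k l) \<and>
      trm_plus L (ep k l) = y k (l + 1) \<and> lab_plus L (ep k l) = \<xi> l \<and> src_plus L (ep k l) = y k l"
    by metis
  define z where "z = restrict (\<lambda>(k, l). (y k l, em k l, ep k l)) Z2lt"
  have z: "vtx z k l = y k l" "edge_minus z k l = em k l" "edge_plus z k l = ep k l" if "k < l" for k l
    using that by (auto simp: z_def vtx_def edge_minus_def edge_plus_def Z2lt_def)
  have "has_labels L z \<xi>"
    using em ep by (auto simp: has_labels_def z Z2lt_def)
  moreover have "z \<in> (\<Pi>\<^sub>E (k, l) \<in> Z2lt. Vert L (level k l) \<times> Eminus L (level k l) \<times> Eplus L (level k l))"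
    unfolding z_def using em ep minus_step_Vert[OF minus]
    by (intro restrict_PiE_iff[THEN iffD2]) (auto simp: Z2lt_def)
  moreover have "\<xi> k \<in> \<Sigma>" for k
    using minus_step_Vert[OF minus[of k "k + 1"]] by simp
  ultimately have "z \<in> config_space \<Sigma> L"
    unfolding config_space_def using em ep by (auto simp: Z2lt_def z)
  then show ?thesis
    using \<open>has_labels L z \<xi>\<close> z by blast
qed

text \<open>
  Keep \<open>x\<close> on the region \<open>k \<le> p\<close>, \<open>q \<le> l\<close> and change only the labels strictly between
  \<open>p\<close> and \<open>q\<close>.  The new word is readable at \<open>(p, q)\<close> by hypothesis.  Readability then
  spreads along the boundary of the region: upwards in column \<open>p\<close>, where upward edges append
  a letter on the right, and leftwards in row \<open>q\<close>, where downward edges prepend a letter.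
  These are the seeds for extending first by columns and then by rows.
\<close>

lemma replace_word:
  assumes fpcc: "FPCC L"
    and x: "x \<in> config_space \<Sigma> L" "has_labels L x \<zeta>"
    and pq: "p < q"
    and lab: "\<And>i. i \<le> p \<Longrightarrow> \<xi> i = \<zeta> i" "\<And>i. q \<le> i \<Longrightarrow> \<xi> i = \<zeta> i"
    and word: "map \<xi> [p + 1..q - 1] \<in> predecessor_words L (level p q) (vtx x p q)"
  shows "\<exists>z \<in> config_space \<Sigma> L. has_labels L z \<xi> \<and> (\<forall>k l. k \<le> p \<longrightarrow> q \<le> l \<longrightarrow> z (k, l) = x (k, l))"
proof -
  have minus: "minus_step L (level k l) (vtx x (k - 1) l) (\<xi> k) (vtx x k l)" if "k \<le> p" "q \<le> l" for k l
    using config_minus_step[OF x, of k l] that pq lab by auto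
  have plus: "plus_step L (level k l) (vtx x k (l + 1)) (\<xi> l) (vtx x k l)" if "k \<le> p" "q \<le> l" for k l
    using config_plus_step[OF x, of k l] that pq lab by auto
  have base: "reads \<xi> p q (vtx x p q)"
    using word config_entry(1)[OF x(1) pq] by (simp add: reads_iff_predecessor_words[OF fpcc])
  have col: "reads \<xi> p l (vtx x p l)" if "q \<le> l" for l
    using that
  proof (induction l rule: int_ge_induct)
    case (step l)
    then show ?case
      using plus[of p l] pq reads_iff_plus_step[OF fpcc, of p l] by auto
  qed (rule base)
  have row: "reads \<xi> k q (vtx x k q)" if "k \<le> p" for k
    using that
  proof (induction k rule: int_le_induct)
    case (step k)
    then show ?case
      using minus[of k q] pq reads_iff_minus_step[of k q] by auto
  qed (rule base)
  obtain c where c: "\<And>k l. k \<le> p \<Longrightarrow> c k l = vtx x k l"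
      "\<And>k l. q \<le> l \<Longrightarrow> k < l \<Longrightarrow> minus_step L (level k l) (c (k - 1) l) (\<xi> k) (c k l)"
      "\<And>k l. q \<le> l \<Longrightarrow> k < l \<Longrightarrow> plus_step L (level k l) (c k (l + 1)) (\<xi> l) (c k l)"
      "\<And>k l. q \<le> l \<Longrightarrow> p \<le> k \<Longrightarrow> k < l \<Longrightarrow> reads \<xi> k l (c k l)"
    by (rule exE[OF extend_columns[of p q "vtx x" \<xi>]]) (use minus plus col in blast)+
  have "reads \<xi> k q (c k q)" if "k < q" for k
    using row[of k] c(1)[of k q] c(4)[of q k] that by (cases "k \<le> p") auto
  note row_q = this
  obtain d where d: "\<And>k l. q \<le> l \<Longrightarrow> d k l = c k l"
      "\<And>k l. k < l \<Longrightarrow> minus_step L (level k l) (d (k - 1) l) (\<xi> k) (d k l)"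
      "\<And>k l. k < l \<Longrightarrow> plus_step L (level k l) (d k (l + 1)) (\<xi> l) (d k l)"
    by (rule exE[OF extend_rows[of q c \<xi>]]) (use fpcc c(2,3) row_q in blast)+
  obtain z where z: "z \<in> config_space \<Sigma> L" "has_labels L z \<xi>" "\<And>k l. k < l \<Longrightarrow> vtx z k l = d k l"
    using config_of_vertices[of d \<xi>] d(2,3) by blast
  have "z (k, l) = x (k, l)" if "k \<le> p" "q \<le> l" for k l
  proof (rule entry_eqI[OF z(1,2) x, of "k - 1" "l + 1"])
    show "vtx z (k - 1) (l + 1) = vtx x (k - 1) (l + 1)"
      using that pq by (simp add: z c d)
  qed (use that pq lab in auto)
  then show ?thesis
    using z by blast
qed

end

section \<open>The configuration space as a compact space\<close>

lemma continuous_map_locally_constant: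
  assumes "f \<in> topspace X \<rightarrow> S"
    and "\<And>x. x \<in> topspace X \<Longrightarrow> \<exists>U. openin X U \<and> x \<in> U \<and> (\<forall>y \<in> U. f y = f x)"
  shows "continuous_map X (discrete_topology S) f"
  unfolding continuous_map_def
proof (intro conjI allI impI)
  show "f \<in> topspace X \<rightarrow> topspace (discrete_topology S)"
    using assms(1) by simp
next
  fix A assume "openin (discrete_topology S) A"
  show "openin X {x \<in> topspace X. f x \<in> A}"
  proof (subst openin_subopen, intro ballI)
    fix x assume x: "x \<in> {x \<in> topspace X. f x \<in> A}"
    then obtain U where "openin X U" "x \<in> U" "\<forall>y \<in> U. f y = f x"
      using assms(2) by blast
    then show "\<exists>T. openin X T \<and> x \<in> T \<and> T \<subseteq> {x \<in> topspace X. f x \<in> A}"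
      using x openin_subset by (intro exI[of _ U]) fastforce
  qed
qed

text \<open>
  Prescribing finitely many coordinates gives a basic open set because the factors are
  discrete.  The complement of a set cut out by finitely many coordinates is of the same kind,
  so such sets are clopen.
\<close>

lemma openin_product_discrete_finitely_determined:
  fixes S :: "'i \<Rightarrow> 'b set" and I :: "'i set"
  defines "X \<equiv> product_topology (\<lambda>i. discrete_topology (S i)) I"
  assumes J: "finite J" "J \<subseteq> I"
    and P: "\<And>x y. x \<in> topspace X \<Longrightarrow> y \<in> topspace X \<Longrightarrow> (\<And>j. j \<in> J \<Longrightarrow> x j = y j) \<Longrightarrow> P x \<Longrightarrow> P y"
  shows "openin X {x \<in> topspace X. P x}"
proof (subst openin_subopen, intro ballI)
  fix x assume x: "x \<in> {x \<in> topspace X. P x}"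
  let ?U = "\<Pi>\<^sub>E i \<in> I. if i \<in> J then {x i} else S i"
  have xi: "x i \<in> S i" if "i \<in> I" for i
    using x that by (auto simp: X_def)
  have "openin X ?U"
    unfolding X_def
  proof (rule product_topology_basis)
    show "openin (discrete_topology (S i)) (if i \<in> J then {x i} else S i)" for i
      using xi J by (auto)
    show "finite {i. (if i \<in> J then {x i} else S i) \<noteq> topspace (discrete_topology (S i))}"
      by (rule finite_subset[OF _ J(1)]) auto
  qed
  moreover have "x \<in> ?U"
    using x by (auto simp: X_def PiE_iff)
  moreover have "?U \<subseteq> {x \<in> topspace X. P x}"
  proof
    fix y assume y: "y \<in> ?U"
    then have "y j = x j" if "j \<in> J" for j
      using PiE_mem[OF y, of j] that J by auto
    moreover have "y \<in> topspace X"
      using y xi by (fastforce simp: X_def PiE_iff split: if_splits)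
    ultimately show "y \<in> {x \<in> topspace X. P x}"
      using x P[of x y] by auto
  qed
  ultimately show "\<exists>T. openin X T \<and> x \<in> T \<and> T \<subseteq> {x \<in> topspace X. P x}"
    by blast
qed

lemma closedin_product_discrete_finitely_determined:
  fixes S :: "'i \<Rightarrow> 'b set" and I :: "'i set"
  defines "X \<equiv> product_topology (\<lambda>i. discrete_topology (S i)) I"
  assumes J: "finite J" "J \<subseteq> I"
    and P: "\<And>x y. x \<in> topspace X \<Longrightarrow> y \<in> topspace X \<Longrightarrow> (\<And>j. j \<in> J \<Longrightarrow> x j = y j) \<Longrightarrow> P x \<Longrightarrow> P y"
  shows "closedin X {x \<in> topspace X. P x}"
proof -
  have "openin X {x \<in> topspace X. \<not> P x}"
    unfolding X_def using J by (rule openin_product_discrete_finitely_determined) (use P X_def in metis)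
  moreover have "{x \<in> topspace X. \<not> P x} = topspace X - {x \<in> topspace X. P x}"
    by blast
  ultimately show ?thesis
    by (auto simp: closedin_def)
qed

definition labels :: "('v, 'm, 'p, 'a) bisystem \<Rightarrow> ('v, 'm, 'p) config \<Rightarrow> int \<Rightarrow> 'a" where
  "labels L x k = lab_minus L (edge_minus x k (k + 1))"

lemma has_labels_eq_labels: "has_labels L x \<xi> \<Longrightarrow> \<xi> = labels L x"
  by (auto simp: labels_def has_labels_def Z2lt_def)

definition entry_space :: "('v, 'm, 'p, 'a) bisystem \<Rightarrow> int \<times> int \<Rightarrow> ('v \<times> 'm \<times> 'p) set" where
  "entry_space L = (\<lambda>(k, l). Vert L (level k l) \<times> Eminus L (level k l) \<times> Eplus L (level k l))"

definition entry_product :: "('v, 'm, 'p, 'a) bisystem \<Rightarrow> ('v, 'm, 'p) config topology" where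
  "entry_product L = product_topology (\<lambda>i. discrete_topology (entry_space L i)) Z2lt"

lemma topspace_entry_product: "topspace (entry_product L) = PiE Z2lt (entry_space L)"
  by (simp add: entry_product_def)

text \<open>
  The defining conditions of a configuration at one position.  The existential quantifier
  over label sequences is removed by taking the canonical candidate \<^const>\<open>labels\<close>, so that
  each condition involves finitely many entries only.
\<close>

definition locally_consistent :: "('v, 'm, 'p, 'a) bisystem \<Rightarrow> ('v, 'm, 'p) config \<Rightarrow> int \<Rightarrow> int \<Rightarrow> bool" where
  "locally_consistent L x k l \<longleftrightarrow>
     src_minus L (edge_minus x k l) = vtx x (k - 1) l \<and>
     trm_minus L (edge_minus x k l) = vtx x k l \<and>
     src_plus L (edge_plus x k l) = vtx x k l \<and>
     trm_plus L (edge_plus x k l) = vtx x k (l + 1) \<and>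
     lab_minus L (edge_minus x k l) = labels L x k \<and>
     lab_plus L (edge_plus x k l) = labels L x l"

context lambda_graph_bisystem
begin

abbreviation X where "X \<equiv> config_topology \<Sigma> L"
abbreviation T where "T \<equiv> tail_rel_topology \<Sigma> L"

lemma has_labels_labels:
  assumes "x \<in> config_space \<Sigma> L"
  shows "has_labels L x (labels L x)"
proof -
  obtain \<xi> where "has_labels L x \<xi>"
    using assms by (auto simp: config_space_def)
  then show ?thesis
    using has_labels_eq_labels by metis
qed

lemma config_space_eq:
  "config_space \<Sigma> L =
     {x \<in> topspace (entry_product L). \<forall>(k, l) \<in> Z2lt. locally_consistent L x k l}"
proof (intro subset_antisym subsetI)
  fix x assume x: "x \<in> config_space \<Sigma> L"
  have "x \<in> topspace (entry_product L)"
    using x by (simp add: config_space_def topspace_entry_product entry_space_def)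
  moreover have "locally_consistent L x k l" if "k < l" for k l
    using config_entry[OF x that] has_labelsD[OF has_labels_labels[OF x] that]
    by (simp add: locally_consistent_def)
  ultimately show "x \<in> {x \<in> topspace (entry_product L). \<forall>(k, l) \<in> Z2lt. locally_consistent L x k l}"
    by (auto simp: Z2lt_def)
next
  fix x assume x: "x \<in> {x \<in> topspace (entry_product L). \<forall>(k, l) \<in> Z2lt. locally_consistent L x k l}"
  then have lc: "\<And>k l. k < l \<Longrightarrow> locally_consistent L x k l"
    by (auto simp: Z2lt_def)
  have P: "x \<in> PiE Z2lt (entry_space L)"
    using x by (simp add: topspace_entry_product)
  have "labels L x k \<in> \<Sigma>" for k
  proof -
    have "x (k, k + 1) \<in> entry_space L (k, k + 1)"
      using P by (rule PiE_mem) (simp add: Z2lt_def)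
    then show ?thesis
      using lab_minus by (auto simp: labels_def edge_minus_def entry_space_def)
  qed
  moreover have "has_labels L x (labels L x)"
    using lc by (auto simp: has_labels_def Z2lt_def locally_consistent_def)
  ultimately show "x \<in> config_space \<Sigma> L"
    unfolding config_space_def using P lc
    by (auto simp: entry_space_def locally_consistent_def Z2lt_def)
qed

lemma closedin_config_space: "closedin (entry_product L) (config_space \<Sigma> L)"
proof -
  have "closedin (entry_product L) {x \<in> topspace (entry_product L). locally_consistent L x k l}"
    if "k < l" for k l
    unfolding entry_product_def
  proof (rule closedin_product_discrete_finitely_determined)
    show "finite {(k, l), (k - 1, l), (k, l + 1), (k, k + 1), (l, l + 1)}"
      by simp
    show "{(k, l), (k - 1, l), (k, l + 1), (k, k + 1), (l, l + 1)} \<subseteq> Z2lt"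
      using that by (auto simp: Z2lt_def)
  qed (simp add: locally_consistent_def labels_def vtx_def edge_minus_def edge_plus_def)
  then have "closedin (entry_product L)
      (\<Inter>(k, l) \<in> Z2lt. {x \<in> topspace (entry_product L). locally_consistent L x k l})"
    by (intro closedin_Inter) (auto simp: Z2lt_def intro: exI[of _ "0::int"] exI[of _ "1::int"])
  moreover have "(\<Inter>(k, l) \<in> Z2lt. {x \<in> topspace (entry_product L). locally_consistent L x k l}) =
      config_space \<Sigma> L"
  proof -
    have "(0, 1) \<in> Z2lt"
      by (simp add: Z2lt_def)
    then show ?thesis
      unfolding config_space_eq by fast
  qed
  ultimately show ?thesis by simp
qed

lemma basic_open_eq:
  "basic_open \<Sigma> L p q \<mu> v =
     {x \<in> config_space \<Sigma> L. vtx x p q = v \<and> map (labels L x) [p + 1..q - 1] = \<mu>}"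
proof (rule set_eqI)
  fix x
  have "(\<exists>\<xi>. has_labels L x \<xi> \<and> map \<xi> [p + 1..q - 1] = \<mu>) \<longleftrightarrow> map (labels L x) [p + 1..q - 1] = \<mu>"
    if "x \<in> config_space \<Sigma> L"
    using has_labels_labels[OF that] has_labels_eq_labels[of L x] by metis
  then show "x \<in> basic_open \<Sigma> L p q \<mu> v \<longleftrightarrow>
      x \<in> {x \<in> config_space \<Sigma> L. vtx x p q = v \<and> map (labels L x) [p + 1..q - 1] = \<mu>}"
    by (auto simp: basic_open_def)
qed

text \<open>
  Membership is decided by the entry at \<open>(p, q)\<close> and by the finitely many entries that
  carry the labels strictly between \<open>p\<close> and \<open>q\<close>.
\<close>

lemma clopen_basic_open_in_product:
  assumes "p < q"
  shows "openin (subtopology (entry_product L) (config_space \<Sigma> L)) (basic_open \<Sigma> L p q \<mu> v)"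
    and "closedin (subtopology (entry_product L) (config_space \<Sigma> L)) (basic_open \<Sigma> L p q \<mu> v)"
proof -
  let ?P = "\<lambda>x. vtx x p q = v \<and> map (labels L x) [p + 1..q - 1] = \<mu>"
  let ?J = "insert (p, q) ((\<lambda>k. (k, k + 1)) ` {p + 1..q - 1})"
  have J: "finite ?J" "?J \<subseteq> Z2lt"
    using assms by (auto simp: Z2lt_def)
  have P: "?P y" if "\<And>j. j \<in> ?J \<Longrightarrow> x j = y j" "?P x" for x y
  proof -
    have "map (labels L x) [p + 1..q - 1] = map (labels L y) [p + 1..q - 1]"
      using that(1) by (intro map_cong) (auto simp: labels_def edge_minus_def)
    moreover have "vtx x p q = vtx y p q"
      using that(1) by (auto simp: vtx_def)
    ultimately show ?thesis
      using that(2) by simp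
  qed
  have eq: "basic_open \<Sigma> L p q \<mu> v = {x \<in> topspace (entry_product L). ?P x} \<inter> config_space \<Sigma> L"
    by (auto simp: basic_open_eq config_space_eq)
  have "openin (entry_product L) {x \<in> topspace (entry_product L). ?P x}"
    unfolding entry_product_def by (rule openin_product_discrete_finitely_determined[OF J P])
  then show "openin (subtopology (entry_product L) (config_space \<Sigma> L)) (basic_open \<Sigma> L p q \<mu> v)"
    unfolding openin_subtopology eq by blast
  have "closedin (entry_product L) {x \<in> topspace (entry_product L). ?P x}"
    unfolding entry_product_def by (rule closedin_product_discrete_finitely_determined[OF J P])
  then show "closedin (subtopology (entry_product L) (config_space \<Sigma> L)) (basic_open \<Sigma> L p q \<mu> v)"
    unfolding closedin_subtopology eq by blast
qed

lemma labels_in_predecessor_words: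
  assumes x: "x \<in> config_space \<Sigma> L" and pq: "p < q"
  shows "map (labels L x) [p + 1..q - 1] \<in> predecessor_words L (level p q) (vtx x p q)"
proof -
  have "p + 1 \<le> q"
    using pq by simp
  then show ?thesis
  proof (induction q rule: int_ge_induct)
    case base
    then show ?case
      by (simp add: level_def predecessor_words_0)
  next
    case (step l)
    then have "map (labels L x) [p + 1..l + 1 - 1] = map (labels L x) [p + 1..l - 1] @ [labels L x l]"
      by (simp add: upto_rec2)
    then show ?case
      using step config_plus_step[OF x has_labels_labels[OF x], of p l]
      by (auto simp: level_succ predecessor_words_Suc)
  qed
qed

lemma openin_basic_open:
  assumes "x \<in> config_space \<Sigma> L" "p < q"
  shows "openin X (basic_open \<Sigma> L p q (map (labels L x) [p + 1..q - 1]) (vtx x p q))"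
  unfolding config_topology_def
  using assms(2) labels_in_predecessor_words[OF assms] config_entry(1)[OF assms]
  by (intro topology_generated_by_Basis CollectI exI conjI refl) (simp_all add: Z2lt_def)

lemma topspace_X [simp]: "topspace X = config_space \<Sigma> L"
proof
  show "topspace X \<subseteq> config_space \<Sigma> L"
    by (auto simp: config_topology_def basic_open_def)
  show "config_space \<Sigma> L \<subseteq> topspace X"
  proof
    fix x assume x: "x \<in> config_space \<Sigma> L"
    have "x \<in> basic_open \<Sigma> L 0 1 (map (labels L x) [0 + 1..1 - 1]) (vtx x 0 1)"
      using x by (simp add: basic_open_eq)
    then show "x \<in> topspace X"
      using openin_subset[OF openin_basic_open[OF x, of 0 1]] by auto
  qed
qed

text \<open>
  The vertex at \<open>(k - 1, l + 1)\<close> and the labels from \<open>k\<close> to \<open>l\<close> fix the whole entry at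
  \<open>(k, l)\<close>, so this entry is constant on a basic open set around each configuration.
\<close>

lemma continuous_map_entry:
  assumes "i \<in> Z2lt"
  shows "continuous_map X (discrete_topology (entry_space L i)) (\<lambda>x. x i)"
proof (rule continuous_map_locally_constant)
  show "(\<lambda>x. x i) \<in> topspace X \<rightarrow> entry_space L i"
    using assms by (auto simp: config_space_eq topspace_entry_product PiE_iff)
next
  fix x assume "x \<in> topspace X"
  then have x: "x \<in> config_space \<Sigma> L" by simp
  obtain k l where i: "i = (k, l)" "k < l"
    using assms by (auto simp: Z2lt_def)
  let ?U = "basic_open \<Sigma> L (k - 1) (l + 1) (map (labels L x) [k - 1 + 1..l + 1 - 1]) (vtx x (k - 1) (l + 1))"
  have "y i = x i" if y: "y \<in> ?U" for y
  proof -
    have y': "y \<in> config_space \<Sigma> L" "vtx y (k - 1) (l + 1) = vtx x (k - 1) (l + 1)"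
        "\<forall>j \<in> {k..l}. labels L y j = labels L x j"
      using y by (auto simp: basic_open_eq)
    show ?thesis
      unfolding i
      by (rule entry_eqI[OF y'(1) has_labels_labels[OF y'(1)] x has_labels_labels[OF x] y'(2)])
        (use i y'(3) in auto)
  qed
  moreover have "x \<in> ?U"
    using x by (simp add: basic_open_eq)
  ultimately show "\<exists>U. openin X U \<and> x \<in> U \<and> (\<forall>y \<in> U. y i = x i)"
    using openin_basic_open[OF x, of "k - 1" "l + 1"] i by (intro exI[of _ ?U]) auto
qed

text \<open>
  Basic open sets are cut out by finitely many entries, and entries are locally constant for
  the topology that they generate; so each of the two topologies contains the other.
  Compactness and metrizability are then inherited from a countable product of finite
  discrete spaces.
\<close>

lemma config_topology_eq: "X = subtopology (entry_product L) (config_space \<Sigma> L)"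
proof -
  let ?Y = "subtopology (entry_product L) (config_space \<Sigma> L)"
  have space: "topspace ?Y = config_space \<Sigma> L"
    by (auto simp: config_space_eq)
  have "continuous_map X (entry_product L) (\<lambda>x. x)"
    unfolding entry_product_def continuous_map_componentwise
    using continuous_map_entry by (auto simp: config_space_eq topspace_entry_product PiE_iff)
  then have XY: "continuous_map X ?Y (\<lambda>x. x)"
    by (auto simp: continuous_map_in_subtopology)
  have YX: "continuous_map ?Y X (\<lambda>x. x)"
    unfolding config_topology_def
  proof (rule continuous_on_generated_topo)
    fix U assume "U \<in> {basic_open \<Sigma> L p q \<mu> v | p q \<mu> v.
       (p, q) \<in> Z2lt \<and> v \<in> Vert L (level p q) \<and> \<mu> \<in> predecessor_words L (level p q) v}"
    then have "openin ?Y U"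
      using clopen_basic_open_in_product by (auto simp: Z2lt_def)
    moreover from this have "(\<lambda>x. x) -` U \<inter> topspace ?Y = U"
      using openin_subset[of ?Y U] by blast
    ultimately show "openin ?Y ((\<lambda>x. x) -` U \<inter> topspace ?Y)"
      by simp
  next
    show "(\<lambda>x. x) ` topspace ?Y \<subseteq> \<Union> {basic_open \<Sigma> L p q \<mu> v | p q \<mu> v.
       (p, q) \<in> Z2lt \<and> v \<in> Vert L (level p q) \<and> \<mu> \<in> predecessor_words L (level p q) v}"
      using space topspace_X unfolding config_topology_def topology_generated_by_topspace by simp
  qed
  have *: "openin A U" if "continuous_map A B (\<lambda>x. x)" "topspace A = topspace B" "openin B U" for A B and U :: "('v, 'm, 'p) config set"
  proof -
    have "{x \<in> topspace A. x \<in> U} = U"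
      using that openin_subset by auto
    then show ?thesis
      using openin_continuous_map_preimage[OF that(1,3)] by simp
  qed
  have "openin X U = openin ?Y U" for U
    using *[OF XY _, of U] *[OF YX _, of U] space topspace_X by metis
  then show ?thesis
    by (simp add: topology_eq)
qed

lemma closedin_basic_open: "p < q \<Longrightarrow> closedin X (basic_open \<Sigma> L p q \<mu> v)"
  unfolding config_topology_eq by (rule clopen_basic_open_in_product)

lemma compact_X: "compact_space X"
proof -
  have "compact_space (entry_product L)"
    unfolding entry_product_def compact_space_product_topology
    using Vert_finite Eminus_finite Eplus_finite by (auto simp: entry_space_def compact_space_discrete_topology)
  then have "compactin (entry_product L) (config_space \<Sigma> L)"
    using closedin_config_space by (rule closedin_compact_space)
  then show ?thesis
    unfolding config_topology_eq by (rule compact_space_subtopology)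
qed

lemma metrizable_X: "metrizable_space X"
  unfolding config_topology_eq entry_product_def
  by (intro metrizable_space_subtopology) (simp add: metrizable_space_product_topology)

lemma Hausdorff_X: "Hausdorff_space X"
  by (rule metrizable_imp_Hausdorff_space[OF metrizable_X])

lemma totally_disconnected_X: "totally_disconnected_space X"
  unfolding totally_disconnected_space_def
proof (intro allI impI)
  fix S assume S: "connectedin X S"
  have S_sub: "S \<subseteq> config_space \<Sigma> L"
    using connectedin_subset_topspace[OF S] by simp
  have eq: "x = y" if "x \<in> S" "y \<in> S" for x y
  proof
    fix i
    show "x i = y i"
    proof (cases "i \<in> Z2lt")
      case True
      have "connectedin (discrete_topology (entry_space L i)) ((\<lambda>x. x i) ` S)"
        by (rule connectedin_continuous_map_image[OF continuous_map_entry[OF True] S])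
      then obtain a where "(\<lambda>x. x i) ` S \<subseteq> {a}"
        unfolding connectedin_discrete_topology by blast
      then show ?thesis
        using that by blast
    next
      case False
      have "x \<in> PiE Z2lt (entry_space L)" "y \<in> PiE Z2lt (entry_space L)"
        using S_sub that by (auto simp: config_space_eq topspace_entry_product)
      then show ?thesis
        using False by (metis PiE_arb)
    qed
  qed
  show "\<exists>a. S \<subseteq> {a}"
    using eq by blast
qed

end

section \<open>The equivalence relation and its topology\<close>

text \<open>
  A continuous injection from a compact set into a Hausdorff space is a homeomorphism onto
  its image; this spares a direct proof that inverse branches are continuous.
\<close>

lemma homeomorphic_map_on_compact_open:
  assumes "continuous_map T X f" "Hausdorff_space X"
    and "compactin T W" "openin T W" "openin X (f ` W)" "inj_on f W"
  shows "homeomorphic_map (subtopology T W) (subtopology X (f ` W)) f"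
proof (rule continuous_imp_homeomorphic_map)
  have sub: "W \<subseteq> topspace T" "f ` W \<subseteq> topspace X"
    using assms openin_subset by blast+
  show "compact_space (subtopology T W)"
    using assms by (simp add: compactin_subspace)
  show "Hausdorff_space (subtopology X (f ` W))"
    using assms by (simp add: Hausdorff_space_subtopology)
  show "continuous_map (subtopology T W) (subtopology X (f ` W)) f"
    using assms sub
    by (intro continuous_map_into_subtopology continuous_map_from_subtopology) auto
  show "f ` topspace (subtopology T W) = topspace (subtopology X (f ` W))"
    using sub by (simp add: inf.absorb2)
  show "inj_on f (topspace (subtopology T W))"
    using assms sub by (simp add: inf.absorb2)
qed

lemma square_rel_mono:
  assumes "p' \<le> p" "q \<le> q'"
  shows "square_rel \<Sigma> L (p, q) \<subseteq> square_rel \<Sigma> L (p', q')"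
proof -
  have "square (p', q') x = square (p', q') z" if "square (p, q) x = square (p, q) z" for x z :: "('v, 'm, 'p) config"
  proof -
    have sub: "{..p} \<times> {q..} \<inter> ({..p'} \<times> {q'..}) = {..p'} \<times> {q'..}"
      using assms by auto
    have "square (p', q') y = restrict (square (p, q) y) ({..p'} \<times> {q'..})" for y :: "('v, 'm, 'p) config"
      unfolding square_def using sub by (simp add: restrict_restrict)
    then show ?thesis
      using that by simp
  qed
  then show ?thesis
    by (auto simp: square_rel_def)
qed

lemma square_rel_iff:
  "(x, z) \<in> square_rel \<Sigma> L (p, q) \<longleftrightarrow>
     x \<in> config_space \<Sigma> L \<and> z \<in> config_space \<Sigma> L \<and> (\<forall>k\<le>p. \<forall>l\<ge>q. x (k, l) = z (k, l))"
proof -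
  have "square (p, q) x = square (p, q) z \<longleftrightarrow> (\<forall>k\<le>p. \<forall>l\<ge>q. x (k, l) = z (k, l))"
    by (auto simp: square_def restrict_def fun_eq_iff)
  then show ?thesis
    by (auto simp: square_rel_def)
qed

lemma equiv_square_rel: "equiv (config_space \<Sigma> L) (square_rel \<Sigma> L pq)"
  by (rule equivI) (auto simp: square_rel_def refl_on_def sym_def trans_def)

lemma square_rel_directed:
  assumes "pq \<in> Z2lt" "pq' \<in> Z2lt"
  shows "\<exists>r \<in> Z2lt. square_rel \<Sigma> L pq \<subseteq> square_rel \<Sigma> L r \<and> square_rel \<Sigma> L pq' \<subseteq> square_rel \<Sigma> L r"
proof -
  obtain p q p' q' where "pq = (p, q)" "pq' = (p', q')"
    by fastforce
  then show ?thesis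
    using assms square_rel_mono[of "min p p'" p q "max q q'" \<Sigma> L] square_rel_mono[of "min p p'" p' q' "max q q'" \<Sigma> L]
    by (intro bexI[of _ "(min p p', max q q')"]) (auto simp: Z2lt_def)
qed

lemma square_rel_sym: "(x, z) \<in> square_rel \<Sigma> L pq \<Longrightarrow> (z, x) \<in> square_rel \<Sigma> L pq"
  by (auto simp: square_rel_def)

lemma equiv_tail_rel: "equiv (config_space \<Sigma> L) (tail_rel \<Sigma> L)"
proof (rule equivI)
  have "(0, 1) \<in> Z2lt"
    by (simp add: Z2lt_def)
  then show "refl_on (config_space \<Sigma> L) (tail_rel \<Sigma> L)"
    by (auto simp: tail_rel_def refl_on_def square_rel_def)
  show "sym (tail_rel \<Sigma> L)"
    unfolding tail_rel_def by (rule symI) (blast intro: square_rel_sym)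
  show "trans (tail_rel \<Sigma> L)"
  proof (rule transI)
    fix x y z assume "(x, y) \<in> tail_rel \<Sigma> L" "(y, z) \<in> tail_rel \<Sigma> L"
    then obtain pq pq' where pq: "pq \<in> Z2lt" "(x, y) \<in> square_rel \<Sigma> L pq"
        "pq' \<in> Z2lt" "(y, z) \<in> square_rel \<Sigma> L pq'"
      by (auto simp: tail_rel_def)
    then obtain r where r: "r \<in> Z2lt" "(x, y) \<in> square_rel \<Sigma> L r" "(y, z) \<in> square_rel \<Sigma> L r"
      using square_rel_directed[OF pq(1,3)] by blast
    have "trans (square_rel \<Sigma> L r)"
      using equiv_square_rel[of \<Sigma> L r] by (simp add: equiv_def)
    then have "(x, z) \<in> square_rel \<Sigma> L r"
      using r(2,3) by (rule transD)
    then show "(x, z) \<in> tail_rel \<Sigma> L"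
      using r by (auto simp: tail_rel_def)
  qed
  show "tail_rel \<Sigma> L \<subseteq> config_space \<Sigma> L \<times> config_space \<Sigma> L"
    by (auto simp: tail_rel_def square_rel_def)
qed

context lambda_graph_bisystem
begin

abbreviation XX where "XX \<equiv> prod_topology X X"

lemma topspace_square_rel_topology [simp]:
  "topspace (square_rel_topology \<Sigma> L pq) = square_rel \<Sigma> L pq"
  by (auto simp: square_rel_topology_def square_rel_def)

lemma openin_T:
  "openin T W \<longleftrightarrow> W \<subseteq> tail_rel \<Sigma> L \<and>
     (\<forall>pq \<in> Z2lt. openin (square_rel_topology \<Sigma> L pq) (W \<inter> square_rel \<Sigma> L pq))"
  unfolding tail_rel_topology_def openin_inductive_limit_topology tail_rel_def by simp

lemma openin_T_restrict:
  assumes "openin XX U"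
  shows "openin T (U \<inter> tail_rel \<Sigma> L)"
proof -
  have "U \<inter> tail_rel \<Sigma> L \<inter> square_rel \<Sigma> L pq = U \<inter> square_rel \<Sigma> L pq" if "pq \<in> Z2lt" for pq
    using that by (auto simp: tail_rel_def)
  then show ?thesis
    using assms by (auto simp: openin_T square_rel_topology_def openin_subtopology)
qed

lemma square_rel_subset_tail_rel: "pq \<in> Z2lt \<Longrightarrow> square_rel \<Sigma> L pq \<subseteq> tail_rel \<Sigma> L"
  by (auto simp: tail_rel_def)

lemma square_rel_labels:
  assumes pq: "p < q" and xz: "(x, z) \<in> square_rel \<Sigma> L (p, q)" and i: "i \<le> p \<or> q \<le> i"
  shows "labels L x i = labels L z i"
proof -
  have hl: "has_labels L x (labels L x)" "has_labels L z (labels L z)"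
    using xz has_labels_labels by (auto simp: square_rel_iff)
  have eq: "x (k, l) = z (k, l)" if "k \<le> p" "q \<le> l" for k l
    using xz that by (auto simp: square_rel_iff)
  show ?thesis
  proof (cases "i \<le> p")
    case True
    then have "lab_minus L (edge_minus x i q) = lab_minus L (edge_minus z i q)"
      using eq by (simp add: edge_minus_def)
    then show ?thesis
      using has_labelsD(1)[OF hl(1)] has_labelsD(1)[OF hl(2)] True pq by simp
  next
    case False
    then have "lab_plus L (edge_plus x p i) = lab_plus L (edge_plus z p i)"
      using eq i by (simp add: edge_plus_def)
    then show ?thesis
      using has_labelsD(2)[OF hl(1)] has_labelsD(2)[OF hl(2)] False i pq by simp
  qed
qed

text \<open>
  If \<open>x\<close> and \<open>z\<close> agree on the square at \<open>(p, q)\<close>, then their labels agree outside the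
  interval between \<open>p\<close> and \<open>q\<close>.  A pair \<open>(x', z')\<close> that agrees on a smaller square, and
  whose labels in the window between \<open>p'\<close> and \<open>q'\<close> are those of \<open>x\<close> and \<open>z\<close>, has the
  same property.  Every entry of the square at \<open>(p, q)\<close> can be read from a vertex
  of the smaller square by labels outside that interval, so \<open>x'\<close> and \<open>z'\<close> agree there.
\<close>

lemma square_relI_near:
  assumes pq: "p < q" and le: "p' \<le> p" "q \<le> q'"
    and xz: "(x, z) \<in> square_rel \<Sigma> L (p, q)"
    and xz': "(x', z') \<in> square_rel \<Sigma> L (p', q')"
    and lx: "\<And>i. p' < i \<Longrightarrow> i < q' \<Longrightarrow> labels L x' i = labels L x i"
    and lz: "\<And>i. p' < i \<Longrightarrow> i < q' \<Longrightarrow> labels L z' i = labels L z i"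
  shows "(x', z') \<in> square_rel \<Sigma> L (p, q)"
proof -
  have cfg: "x \<in> config_space \<Sigma> L" "z \<in> config_space \<Sigma> L" "x' \<in> config_space \<Sigma> L" "z' \<in> config_space \<Sigma> L"
    using xz xz' by (auto simp: square_rel_iff)
  note hl = cfg[THEN has_labels_labels]
  have eq': "x' (k, l) = z' (k, l)" if "k \<le> p'" "q' \<le> l" for k l
    using xz' that by (auto simp: square_rel_iff)
  have lab: "labels L x' i = labels L z' i" if i: "i \<le> p \<or> q \<le> i" for i
  proof (cases "p' < i \<and> i < q'")
    case True
    then show ?thesis
      using lx[of i] lz[of i] square_rel_labels[OF pq xz i] by simp
  next
    case False
    then show ?thesis
      using square_rel_labels[OF _ xz'] pq le by auto
  qed
  have "x' (k, l) = z' (k, l)" if kl: "k \<le> p" "q \<le> l" for k l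
  proof (rule entry_eqI[OF cfg(3) hl(3) cfg(4) hl(4)])
    show "vtx x' (min (k - 1) p') (max (l + 1) q') = vtx z' (min (k - 1) p') (max (l + 1) q')"
      using eq'[of "min (k - 1) p'" "max (l + 1) q'"] by (simp add: vtx_def)
  qed (use kl pq lab in auto)
  then show ?thesis
    using cfg by (simp add: square_rel_iff)
qed

lemma openin_XX_basic_open_Times:
  assumes "x \<in> config_space \<Sigma> L" "z \<in> config_space \<Sigma> L" "p < q"
  shows "openin XX (basic_open \<Sigma> L p q (map (labels L x) [p + 1..q - 1]) (vtx x p q) \<times>
    basic_open \<Sigma> L p q (map (labels L z) [p + 1..q - 1]) (vtx z p q))"
  using openin_basic_open assms by (simp add: openin_prod_Times_iff)

text \<open>
  Inside another stage, prescribing the labels in the window of \<open>square_relI_near\<close> gives a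
  neighbourhood on which agreement on the given square persists.
\<close>

lemma openin_T_square_rel:
  assumes "pq \<in> Z2lt"
  shows "openin T (square_rel \<Sigma> L pq)"
proof -
  obtain p q where pq: "pq = (p, q)" "p < q"
    using assms by (auto simp: Z2lt_def)
  have "openin (square_rel_topology \<Sigma> L (a, b)) (square_rel \<Sigma> L pq \<inter> square_rel \<Sigma> L (a, b))"
    if ab: "a < b" for a b
  proof (subst openin_subopen, intro ballI)
    fix w assume w: "w \<in> square_rel \<Sigma> L pq \<inter> square_rel \<Sigma> L (a, b)"
    obtain x z where xz: "w = (x, z)" by fastforce
    then have cfg: "x \<in> config_space \<Sigma> L" "z \<in> config_space \<Sigma> L"
      using w by (auto simp: square_rel_def)
    \<comment> \<open>a corner inside both squares, so that one window serves both stages\<close>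
    let ?p = "min p a" and ?q = "max q b"
    let ?B = "\<lambda>x. basic_open \<Sigma> L ?p ?q (map (labels L x) [?p + 1..?q - 1]) (vtx x ?p ?q)"
    have "openin XX (?B x \<times> ?B z)"
      using cfg pq by (intro openin_XX_basic_open_Times) auto
    then have "openin (square_rel_topology \<Sigma> L (a, b)) ((?B x \<times> ?B z) \<inter> square_rel \<Sigma> L (a, b))"
      by (auto simp: square_rel_topology_def openin_subtopology)
    moreover have "w \<in> (?B x \<times> ?B z) \<inter> square_rel \<Sigma> L (a, b)"
      using cfg xz w by (simp add: basic_open_eq)
    moreover have "(?B x \<times> ?B z) \<inter> square_rel \<Sigma> L (a, b) \<subseteq> square_rel \<Sigma> L pq"
    proof
      fix w' assume w': "w' \<in> (?B x \<times> ?B z) \<inter> square_rel \<Sigma> L (a, b)"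
      obtain x' z' where xz': "w' = (x', z')" by fastforce
      have xz'_rel: "(x', z') \<in> square_rel \<Sigma> L (?p, ?q)"
        using w' xz' square_rel_mono[of ?p a b ?q \<Sigma> L] by auto
      have lab: "labels L x' i = labels L x i" "labels L z' i = labels L z i"
        if "?p < i" "i < ?q" for i
        using w' xz' that by (auto simp: basic_open_eq)
      have xz_rel: "(x, z) \<in> square_rel \<Sigma> L (p, q)"
        using w xz pq by simp
      have "(x', z') \<in> square_rel \<Sigma> L (p, q)"
        by (rule square_relI_near[OF pq(2) _ _ xz_rel xz'_rel lab]) simp_all
      then show "w' \<in> square_rel \<Sigma> L pq"
        using pq xz' by simp
    qed
    ultimately show "\<exists>V. openin (square_rel_topology \<Sigma> L (a, b)) V \<and> w \<in> V \<and>
        V \<subseteq> square_rel \<Sigma> L pq \<inter> square_rel \<Sigma> L (a, b)"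
      by (intro exI[of _ "(?B x \<times> ?B z) \<inter> square_rel \<Sigma> L (a, b)"]) blast
  qed
  then show ?thesis
    using square_rel_subset_tail_rel[OF assms] by (auto simp: openin_T Z2lt_def)
qed

lemma topspace_T [simp]: "topspace T = tail_rel \<Sigma> L"
proof
  show "topspace T \<subseteq> tail_rel \<Sigma> L"
    using openin_T[of "topspace T"] by simp
  show "tail_rel \<Sigma> L \<subseteq> topspace T"
    using openin_T_square_rel openin_subset by (fastforce simp: tail_rel_def)
qed

lemma continuous_map_inclusion_T:
  assumes "pq \<in> Z2lt"
  shows "continuous_map (square_rel_topology \<Sigma> L pq) T (\<lambda>g. g)"
  unfolding continuous_map_def
proof (intro conjI allI impI)
  show "(\<lambda>g. g) \<in> topspace (square_rel_topology \<Sigma> L pq) \<rightarrow> topspace T"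
    using square_rel_subset_tail_rel[OF assms] by auto
next
  fix U assume "openin T U"
  then have "openin (square_rel_topology \<Sigma> L pq) (U \<inter> square_rel \<Sigma> L pq)"
    using assms by (simp add: openin_T)
  moreover have "{g \<in> topspace (square_rel_topology \<Sigma> L pq). g \<in> U} = U \<inter> square_rel \<Sigma> L pq"
    by auto
  ultimately show "openin (square_rel_topology \<Sigma> L pq) {g \<in> topspace (square_rel_topology \<Sigma> L pq). g \<in> U}"
    by simp
qed

lemma continuous_map_T_XX: "continuous_map T XX (\<lambda>g. g)"
  unfolding continuous_map_def
proof (intro conjI allI impI)
  show "(\<lambda>g. g) \<in> topspace T \<rightarrow> topspace XX"
    by (auto simp: tail_rel_def square_rel_def)
next
  fix U assume "openin XX U"
  then have "openin T (U \<inter> tail_rel \<Sigma> L)"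
    by (rule openin_T_restrict)
  moreover have "{g \<in> topspace T. g \<in> U} = U \<inter> tail_rel \<Sigma> L"
    by auto
  ultimately show "openin T {g \<in> topspace T. g \<in> U}"
    by simp
qed

lemma continuous_map_T_fst: "continuous_map T X fst"
  using continuous_map_compose[OF continuous_map_T_XX continuous_map_fst] by (simp add: o_def)

lemma continuous_map_T_snd: "continuous_map T X snd"
  using continuous_map_compose[OF continuous_map_T_XX continuous_map_snd] by (simp add: o_def)

text \<open>
  Since every stage carries the relative product topology, a map that locally stays inside
  one stage is continuous as soon as it is continuous into the product.
\<close>

lemma continuous_map_into_T:
  assumes cont: "continuous_map Y XX f"
    and loc: "\<And>y. y \<in> topspace Y \<Longrightarrow>
      \<exists>pq \<in> Z2lt. \<exists>U. openin Y U \<and> y \<in> U \<and> f ` U \<subseteq> square_rel \<Sigma> L pq"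
  shows "continuous_map Y T f"
  unfolding continuous_map_def
proof (intro conjI allI impI)
  show "f \<in> topspace Y \<rightarrow> topspace T"
    using loc by (fastforce simp: tail_rel_def)
next
  fix W assume W: "openin T W"
  show "openin Y {y \<in> topspace Y. f y \<in> W}"
  proof (subst openin_subopen, intro ballI)
    fix y assume y: "y \<in> {y \<in> topspace Y. f y \<in> W}"
    then obtain pq U where pq: "pq \<in> Z2lt" and U: "openin Y U" "y \<in> U" "f ` U \<subseteq> square_rel \<Sigma> L pq"
      using loc by blast
    have "openin (square_rel_topology \<Sigma> L pq) (W \<inter> square_rel \<Sigma> L pq)"
      using W pq by (simp add: openin_T)
    then obtain O' where O': "openin XX O'" "W \<inter> square_rel \<Sigma> L pq = O' \<inter> square_rel \<Sigma> L pq"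
      by (auto simp: square_rel_topology_def openin_subtopology)
    have "openin Y (U \<inter> {y \<in> topspace Y. f y \<in> O'})"
      using U(1) openin_continuous_map_preimage[OF cont O'(1)] by (rule openin_Int)
    moreover have "y \<in> U \<inter> {y \<in> topspace Y. f y \<in> O'}"
      using y U O' by blast
    moreover have "U \<inter> {y \<in> topspace Y. f y \<in> O'} \<subseteq> {y \<in> topspace Y. f y \<in> W}"
      using U O' by blast
    ultimately show "\<exists>V. openin Y V \<and> y \<in> V \<and> V \<subseteq> {y \<in> topspace Y. f y \<in> W}"
      by blast
  qed
qed

text \<open>
  Equality of entries is a closed condition, as entries are continuous with discrete values.
\<close>

lemma closedin_square_rel:
  assumes "pq \<in> Z2lt"
  shows "closedin XX (square_rel \<Sigma> L pq)"
proof -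
  obtain p q where pq: "pq = (p, q)" "p < q"
    using assms by (auto simp: Z2lt_def)
  let ?E = "\<lambda>i. {w \<in> topspace XX. fst w i = snd w i}"
  have "closedin XX (?E (k, l))" if "k \<le> p" "q \<le> l" for k l
  proof (rule closedin_continuous_maps_eq)
    have kl: "(k, l) \<in> Z2lt"
      using that pq by (simp add: Z2lt_def)
    show "Hausdorff_space (discrete_topology (entry_space L (k, l)))"
      by simp
    show "continuous_map XX (discrete_topology (entry_space L (k, l))) (\<lambda>w. fst w (k, l))"
      using continuous_map_compose[OF continuous_map_fst continuous_map_entry[OF kl]] by (simp add: o_def)
    show "continuous_map XX (discrete_topology (entry_space L (k, l))) (\<lambda>w. snd w (k, l))"
      using continuous_map_compose[OF continuous_map_snd continuous_map_entry[OF kl]] by (simp add: o_def)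
  qed
  then have "closedin XX (\<Inter>i \<in> {..p} \<times> {q..}. ?E i)"
    by (intro closedin_Inter) auto
  moreover have "(\<Inter>i \<in> {..p} \<times> {q..}. ?E i) = square_rel \<Sigma> L pq"
  proof (intro subset_antisym subrelI)
    fix x z assume *: "(x, z) \<in> (\<Inter>i \<in> {..p} \<times> {q..}. ?E i)"
    then have "(x, z) \<in> ?E (k, l)" if "k \<le> p" "q \<le> l" for k l
      using that by blast
    then show "(x, z) \<in> square_rel \<Sigma> L pq"
      unfolding pq by (auto simp: square_rel_iff)
  qed (auto simp: pq square_rel_iff)
  ultimately show ?thesis by simp
qed

text \<open>
  Compactness is transported from the product along the continuous inclusion of a stage
  into the inductive limit.
\<close>

lemma compactin_T:
  assumes "pq \<in> Z2lt" "closedin XX W" "W \<subseteq> square_rel \<Sigma> L pq"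
  shows "compactin T W"
proof -
  have "compact_space XX"
    using compact_X by (simp add: compact_space_prod_topology)
  then have "compactin XX W"
    using assms(2) by (rule closedin_compact_space)
  then have "compactin (square_rel_topology \<Sigma> L pq) W"
    using assms(3) by (simp add: square_rel_topology_def compactin_subtopology)
  from image_compactin[OF this continuous_map_inclusion_T[OF assms(1)]] show ?thesis
    by simp
qed

text \<open>
  Within one stage the first component leaves only the labels strictly between \<open>p\<close> and
  \<open>q\<close> of the second one undetermined; once these are given, every entry can be read from
  a vertex of the square.
\<close>

lemma square_rel_eqI:
  assumes pq: "p < q" and xz: "(x, z) \<in> square_rel \<Sigma> L (p, q)" and xz': "(x', z') \<in> square_rel \<Sigma> L (p, q)"
    and eq: "x = x'"
    and lab: "map (labels L z) [p + 1..q - 1] = map (labels L z') [p + 1..q - 1]"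
  shows "z = z'"
proof -
  have zz': "(z, z') \<in> square_rel \<Sigma> L (p, q)"
    using xz xz' eq by (auto simp: square_rel_iff)
  then have Z: "z \<in> config_space \<Sigma> L" "z' \<in> config_space \<Sigma> L"
    by (auto simp: square_rel_iff)
  note hl = Z[THEN has_labels_labels]
  have agree: "z (k, l) = z' (k, l)" if "k \<le> p" "q \<le> l" for k l
    using zz' that by (auto simp: square_rel_iff)
  have labs: "labels L z i = labels L z' i" for i
  proof -
    consider "i \<le> p \<or> q \<le> i" | "i \<in> {p + 1..q - 1}"
      by fastforce
    then show ?thesis
    proof cases
      case 1
      then show ?thesis
        by (rule square_rel_labels[OF pq zz'])
    next
      case 2
      then show ?thesis
        using lab by auto
    qed
  qed
  show ?thesis
  proof
    fix i :: "int \<times> int"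
    obtain k l where i: "i = (k, l)" by fastforce
    show "z i = z' i"
    proof (cases "k < l")
      case True
      show ?thesis
        unfolding i
      proof (rule entry_eqI[OF Z(1) hl(1) Z(2) hl(2)])
        show "vtx z (min (k - 1) p) (max (l + 1) q) = vtx z' (min (k - 1) p) (max (l + 1) q)"
          using agree[of "min (k - 1) p" "max (l + 1) q"] by (simp add: vtx_def)
      qed (use True labs in auto)
    next
      case False
      have "z \<in> PiE Z2lt (entry_space L)" "z' \<in> PiE Z2lt (entry_space L)" "i \<notin> Z2lt"
        using Z False i by (auto simp: config_space_eq topspace_entry_product Z2lt_def)
      then show ?thesis
        by (metis PiE_arb)
    qed
  qed
qed

text \<open>
  The word of \<open>z\<close> is a predecessor word of the corner vertex, which \<open>x\<close>, \<open>z\<close> and \<open>y\<close>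
  have in common; hence it can be substituted for the word of \<open>y\<close> without changing the square.
\<close>

lemma replace_basic_open:
  assumes fpcc: "FPCC L" and pq: "p < q" and xz: "(x, z) \<in> square_rel \<Sigma> L (p, q)"
    and y: "y \<in> basic_open \<Sigma> L p q (map (labels L x) [p + 1..q - 1]) (vtx x p q)"
  shows "\<exists>y' \<in> basic_open \<Sigma> L p q (map (labels L z) [p + 1..q - 1]) (vtx z p q).
    (y, y') \<in> square_rel \<Sigma> L (p, q)"
proof -
  have Z: "z \<in> config_space \<Sigma> L" and vxz: "vtx x p q = vtx z p q"
    using xz by (auto simp: square_rel_iff vtx_def)
  have Y: "y \<in> config_space \<Sigma> L" and vy: "vtx y p q = vtx z p q"
    using y vxz by (auto simp: basic_open_eq)
  define \<xi> where "\<xi> i = (if p < i \<and> i < q then labels L z i else labels L y i)" for i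
  have word: "map \<xi> [p + 1..q - 1] = map (labels L z) [p + 1..q - 1]"
    by (auto simp: \<xi>_def)
  have "map \<xi> [p + 1..q - 1] \<in> predecessor_words L (level p q) (vtx y p q)"
    unfolding word vy by (rule labels_in_predecessor_words[OF Z pq])
  then obtain y' where y': "y' \<in> config_space \<Sigma> L" "has_labels L y' \<xi>"
      "\<And>k l. k \<le> p \<Longrightarrow> q \<le> l \<Longrightarrow> y' (k, l) = y (k, l)"
    using replace_word[OF fpcc Y has_labels_labels[OF Y] pq, of \<xi>] pq by (auto simp: \<xi>_def)
  have "vtx y' p q = vtx z p q"
    using y'(3)[of p q] vy by (simp add: vtx_def)
  moreover have "map (labels L y') [p + 1..q - 1] = map (labels L z) [p + 1..q - 1]"
    using word has_labels_eq_labels[OF y'(2)] by simp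
  ultimately have "y' \<in> basic_open \<Sigma> L p q (map (labels L z) [p + 1..q - 1]) (vtx z p q)"
    using y'(1) by (simp add: basic_open_eq)
  moreover have "(y, y') \<in> square_rel \<Sigma> L (p, q)"
    using Y y' by (simp add: square_rel_iff)
  ultimately show ?thesis by blast
qed

text \<open>
  In the stage at \<open>(p, q)\<close>, prescribe the words that both components carry between \<open>p\<close> and
  \<open>q\<close> and the common corner vertex.  On this clopen piece either component determines the
  other one, and exchanging the words shows that both projections fill basic open sets.
\<close>

lemma compact_open_bisection:
  assumes fpcc: "FPCC L" and g: "g \<in> tail_rel \<Sigma> L"
  shows "\<exists>W. g \<in> W \<and> openin T W \<and> compactin T W \<and> inj_on fst W \<and> inj_on snd W \<and>
    openin X (fst ` W) \<and> openin X (snd ` W)"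
proof -
  obtain x z p q where xz: "g = (x, z)" "(x, z) \<in> square_rel \<Sigma> L (p, q)" and pq: "p < q"
    using g by (cases g) (auto simp: tail_rel_def Z2lt_def)
  then have pqZ: "(p, q) \<in> Z2lt"
    by (simp add: Z2lt_def)
  have cfg: "x \<in> config_space \<Sigma> L" "z \<in> config_space \<Sigma> L"
    using xz by (auto simp: square_rel_iff)
  let ?U = "\<lambda>x. basic_open \<Sigma> L p q (map (labels L x) [p + 1..q - 1]) (vtx x p q)"
  define W where "W = (?U x \<times> ?U z) \<inter> square_rel \<Sigma> L (p, q)"
  have "openin T ((?U x \<times> ?U z) \<inter> tail_rel \<Sigma> L \<inter> square_rel \<Sigma> L (p, q))"
    using openin_T_restrict[OF openin_XX_basic_open_Times[OF cfg pq]] openin_T_square_rel[OF pqZ]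
    by (rule openin_Int)
  moreover have "(?U x \<times> ?U z) \<inter> tail_rel \<Sigma> L \<inter> square_rel \<Sigma> L (p, q) = W"
    unfolding W_def using square_rel_subset_tail_rel[OF pqZ] by blast
  ultimately have "openin T W" by simp
  moreover have "compactin T W"
  proof (rule compactin_T[OF pqZ])
    have "closedin XX (?U x \<times> ?U z)"
      using closedin_basic_open[OF pq] by (simp add: closedin_prod_Times_iff)
    then show "closedin XX W"
      unfolding W_def using closedin_square_rel[OF pqZ] by (rule closedin_Int)
  qed (simp add: W_def)
  moreover have "g \<in> W"
    using cfg xz by (simp add: W_def basic_open_eq)
  moreover have "fst ` W = ?U x"
  proof (intro subset_antisym subsetI)
    fix y assume "y \<in> ?U x"
    from replace_basic_open[OF fpcc pq xz(2) this] obtain y' where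
      "y' \<in> ?U z" "(y, y') \<in> square_rel \<Sigma> L (p, q)"
      by blast
    then have "(y, y') \<in> W"
      using \<open>y \<in> ?U x\<close> by (simp add: W_def)
    then show "y \<in> fst ` W"
      by (rule rev_image_eqI) simp
  qed (auto simp: W_def)
  moreover have "snd ` W = ?U z"
  proof (intro subset_antisym subsetI)
    fix y assume "y \<in> ?U z"
    from replace_basic_open[OF fpcc pq square_rel_sym[OF xz(2)] this] obtain y' where
      "y' \<in> ?U x" "(y, y') \<in> square_rel \<Sigma> L (p, q)"
      by blast
    then have "(y', y) \<in> W"
      using \<open>y \<in> ?U z\<close> square_rel_sym by (simp add: W_def)
    then show "y \<in> snd ` W"
      by (rule rev_image_eqI) simp
  qed (auto simp: W_def)
  moreover have "inj_on fst W"
  proof (rule inj_onI)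
    fix w w' assume w: "w \<in> W" "w' \<in> W" "fst w = fst w'"
    have *: "(fst w, snd w) \<in> square_rel \<Sigma> L (p, q)" "(fst w', snd w') \<in> square_rel \<Sigma> L (p, q)"
        "map (labels L (snd w)) [p + 1..q - 1] = map (labels L (snd w')) [p + 1..q - 1]"
      using w(1,2) by (auto simp: W_def basic_open_eq)
    have "snd w = snd w'"
      by (rule square_rel_eqI[OF pq *(1,2) w(3) *(3)])
    then show "w = w'"
      using w by (simp add: prod_eq_iff)
  qed
  moreover have "inj_on snd W"
  proof (rule inj_onI)
    fix w w' assume w: "w \<in> W" "w' \<in> W" "snd w = snd w'"
    have *: "(fst w, snd w) \<in> square_rel \<Sigma> L (p, q)" "(fst w', snd w') \<in> square_rel \<Sigma> L (p, q)"
        "map (labels L (fst w)) [p + 1..q - 1] = map (labels L (fst w')) [p + 1..q - 1]"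
      using w(1,2) by (auto simp: W_def basic_open_eq)
    have "fst w = fst w'"
      by (rule square_rel_eqI[OF pq *(1,2)[THEN square_rel_sym] w(3) *(3)])
    then show "w = w'"
      using w by (simp add: prod_eq_iff)
  qed
  ultimately show ?thesis
    using openin_basic_open[OF cfg(1) pq] openin_basic_open[OF cfg(2) pq] by (intro exI[of _ W]) simp
qed

lemma topological_groupoid_tail_rel: "topological_groupoid_relation X (tail_rel \<Sigma> L) T"
  unfolding topological_groupoid_relation_def
proof (intro conjI)
  show "equiv (topspace X) (tail_rel \<Sigma> L)"
    by (simp add: equiv_tail_rel)
  show "topspace T = tail_rel \<Sigma> L" "continuous_map T X fst" "continuous_map T X snd"
    by (simp_all add: continuous_map_T_fst continuous_map_T_snd)
  show "continuous_map X T (\<lambda>x. (x, x))"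
  proof (rule continuous_map_into_T)
    show "continuous_map X XX (\<lambda>x. (x, x))"
      by (intro continuous_map_pairedI) simp_all
    fix y assume "y \<in> topspace X"
    moreover have "(\<lambda>x. (x, x)) ` topspace X \<subseteq> square_rel \<Sigma> L (0, 1)" "(0, 1) \<in> Z2lt"
      by (auto simp: square_rel_def Z2lt_def)
    ultimately show "\<exists>pq \<in> Z2lt. \<exists>U. openin X U \<and> y \<in> U \<and> (\<lambda>x. (x, x)) ` U \<subseteq> square_rel \<Sigma> L pq"
      using openin_topspace by blast
  qed
  show "continuous_map T T (\<lambda>(x, y). (y, x))"
  proof (rule continuous_map_into_T)
    show "continuous_map T XX (\<lambda>(x, y). (y, x))"
      unfolding case_prod_unfold
      by (intro continuous_map_pairedI continuous_map_T_fst continuous_map_T_snd)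
    fix g assume "g \<in> topspace T"
    then obtain pq where pq: "pq \<in> Z2lt" "g \<in> square_rel \<Sigma> L pq"
      by (auto simp: tail_rel_def)
    moreover have "(\<lambda>(x, y). (y, x)) ` square_rel \<Sigma> L pq \<subseteq> square_rel \<Sigma> L pq"
      by (auto intro: square_rel_sym)
    ultimately show "\<exists>pq \<in> Z2lt. \<exists>U. openin T U \<and> g \<in> U \<and> (\<lambda>(x, y). (y, x)) ` U \<subseteq> square_rel \<Sigma> L pq"
      using openin_T_square_rel by blast
  qed
  let ?C = "{(g, h). snd g = fst h} :: ((('v, 'm, 'p) config \<times> ('v, 'm, 'p) config) \<times> (('v, 'm, 'p) config \<times> ('v, 'm, 'p) config)) set"
  let ?Y = "subtopology (prod_topology T T) ?C"
  show "continuous_map ?Y T (\<lambda>(g, h). (fst g, snd h))"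
  proof (rule continuous_map_into_T)
    have "continuous_map (prod_topology T T) X (\<lambda>w. fst (fst w))"
      using continuous_map_compose[OF continuous_map_fst continuous_map_T_fst] by (simp add: o_def)
    moreover have "continuous_map (prod_topology T T) X (\<lambda>w. snd (snd w))"
      using continuous_map_compose[OF continuous_map_snd continuous_map_T_snd] by (simp add: o_def)
    ultimately show "continuous_map ?Y XX (\<lambda>(g, h). (fst g, snd h))"
      unfolding case_prod_unfold
      by (intro continuous_map_pairedI continuous_map_from_subtopology)
    fix w assume "w \<in> topspace ?Y"
    then obtain g h where w: "w = (g, h)" "snd g = fst h" and gh: "g \<in> tail_rel \<Sigma> L" "h \<in> tail_rel \<Sigma> L"
      by (cases w) simp
    obtain pq pq' where pq: "pq \<in> Z2lt" "g \<in> square_rel \<Sigma> L pq" "pq' \<in> Z2lt" "h \<in> square_rel \<Sigma> L pq'"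
      using gh unfolding tail_rel_def by blast
    obtain r where r: "r \<in> Z2lt" "g \<in> square_rel \<Sigma> L r" "h \<in> square_rel \<Sigma> L r"
      using square_rel_directed[OF pq(1,3), of \<Sigma> L] pq(2,4) by blast
    let ?R = "square_rel \<Sigma> L r"
    have "openin (prod_topology T T) (?R \<times> ?R)"
      using openin_T_square_rel[OF r(1)] by (simp add: openin_prod_Times_iff)
    then have "openin ?Y ((?R \<times> ?R) \<inter> ?C)"
      unfolding openin_subtopology by blast
    moreover have "w \<in> (?R \<times> ?R) \<inter> ?C"
      using w r by simp
    moreover have "(\<lambda>(g, h). (fst g, snd h)) ` ((?R \<times> ?R) \<inter> ?C) \<subseteq> ?R"
      by (auto simp: square_rel_def)
    ultimately show "\<exists>pq \<in> Z2lt. \<exists>U. openin ?Y U \<and> w \<in> U \<and>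
        (\<lambda>(g, h). (fst g, snd h)) ` U \<subseteq> square_rel \<Sigma> L pq"
      by (intro bexI[OF _ r(1)] exI[of _ "(?R \<times> ?R) \<inter> ?C"] conjI)
  qed
qed

lemma etale_tail_rel:
  assumes "FPCC L"
  shows "etale_equivalence_relation X (tail_rel \<Sigma> L) T"
proof -
  have "local_homeomorphism T X fst"
    unfolding local_homeomorphism_def
  proof
    fix g assume "g \<in> topspace T"
    then have "g \<in> tail_rel \<Sigma> L"
      by simp
    from compact_open_bisection[OF assms this] obtain W
      where "g \<in> W" "openin T W" "compactin T W" "inj_on fst W" "openin X (fst ` W)"
      by blast
    then show "\<exists>U. openin T U \<and> g \<in> U \<and> openin X (fst ` U) \<and>
        homeomorphic_map (subtopology T U) (subtopology X (fst ` U)) fst"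
      using homeomorphic_map_on_compact_open[OF continuous_map_T_fst Hausdorff_X, of W] by blast
  qed
  moreover have "local_homeomorphism T X snd"
    unfolding local_homeomorphism_def
  proof
    fix g assume "g \<in> topspace T"
    then have "g \<in> tail_rel \<Sigma> L"
      by simp
    from compact_open_bisection[OF assms this] obtain W
      where "g \<in> W" "openin T W" "compactin T W" "inj_on snd W" "openin X (snd ` W)"
      by blast
    then show "\<exists>U. openin T U \<and> g \<in> U \<and> openin X (snd ` U) \<and>
        homeomorphic_map (subtopology T U) (subtopology X (snd ` U)) snd"
      using homeomorphic_map_on_compact_open[OF continuous_map_T_snd Hausdorff_X, of W] by blast
  qed
  ultimately show ?thesis
    unfolding etale_equivalence_relation_def
    using compact_X metrizable_X topological_groupoid_tail_rel by blast
qed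

lemma tail_rel_eq_UN_nat: "tail_rel \<Sigma> L = (\<Union>n::nat. square_rel \<Sigma> L (- int n, int n + 1))"
proof (intro subset_antisym subsetI)
  fix g assume "g \<in> tail_rel \<Sigma> L"
  then obtain pq where g: "g \<in> square_rel \<Sigma> L pq"
    unfolding tail_rel_def by blast
  obtain p q where pq: "pq = (p, q)"
    by fastforce
  define n where "n = nat (\<bar>p\<bar> + \<bar>q\<bar>)"
  have "- int n \<le> p" "q \<le> int n + 1"
    by (simp_all add: n_def)
  then have "square_rel \<Sigma> L pq \<subseteq> square_rel \<Sigma> L (- int n, int n + 1)"
    unfolding pq by (rule square_rel_mono)
  then show "g \<in> (\<Union>n::nat. square_rel \<Sigma> L (- int n, int n + 1))"
    using g by blast
next
  fix g assume "g \<in> (\<Union>n::nat. square_rel \<Sigma> L (- int n, int n + 1))"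
  then obtain n where "g \<in> square_rel \<Sigma> L (- int n, int n + 1)"
    by blast
  moreover have "(- int n, int n + 1) \<in> Z2lt"
    by (simp add: Z2lt_def)
  ultimately show "g \<in> tail_rel \<Sigma> L"
    unfolding tail_rel_def by blast
qed

lemma AF_tail_rel:
  assumes "FPCC L"
  shows "AF_equivalence_relation X (tail_rel \<Sigma> L) T"
  unfolding AF_equivalence_relation_def
proof (intro conjI exI[of _ "\<lambda>n::nat. square_rel \<Sigma> L (- int n, int n + 1)"] allI)
  fix n :: nat
  have n: "(- int n, int n + 1) \<in> Z2lt"
    by (simp add: Z2lt_def)
  show "square_rel \<Sigma> L (- int n, int n + 1) \<subseteq> square_rel \<Sigma> L (- int (Suc n), int (Suc n) + 1)"
    by (rule square_rel_mono) auto
  show "compactin T (square_rel \<Sigma> L (- int n, int n + 1))"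
    using compactin_T[OF n closedin_square_rel[OF n]] by simp
  show "openin T (square_rel \<Sigma> L (- int n, int n + 1))"
    by (rule openin_T_square_rel[OF n])
  show "equiv (topspace X) (square_rel \<Sigma> L (- int n, int n + 1))"
    by (simp add: equiv_square_rel)
qed (rule etale_tail_rel[OF assms] totally_disconnected_X tail_rel_eq_UN_nat)+

end

theorem proposition5p3:
  fixes \<Sigma> :: "'a set" and L :: "('v, 'm, 'p, 'a) bisystem"
  assumes "lambda_graph_bisystem \<Sigma> L"
    and "FPCC L"
  shows "etale_equivalence_relation (config_topology \<Sigma> L) (tail_rel \<Sigma> L) (tail_rel_topology \<Sigma> L) \<and>
         AF_equivalence_relation (config_topology \<Sigma> L) (tail_rel \<Sigma> L) (tail_rel_topology \<Sigma> L)"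
  using lambda_graph_bisystem.etale_tail_rel[OF assms] lambda_graph_bisystem.AF_tail_rel[OF assms] by blast

end
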